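(* The scattering function $S(\lambda)$ of the pair $\{L_n,L_0\}$ has the multiplicative expansion $$S(\lambda)=S_1(\lambda)\cdots S_n(\lambda),\qquad S_k(\lambda)=-\frac{r_k(-\lambda)}{r_k(\lambda)}\quad(1\le k\le n),$$ for $\lambda\in\mathbb{R}\setminus\{0\}$ for which the boundary values involved exist and the denominators do not vanish, where $r_k(\lambda)=-\dfrac{2i\lambda}{\alpha_k}\,b_k(\lambda^2)$ and $b_k(z)=1+\alpha_k\langle R_{k-1}(z)v_k,v_k\rangle$.
   Context: Let $n\in\mathbb{N}$, let $\alpha_1,\dots,\alpha_n$ be non-zero real numbers, and let $v_1,\dots,v_n$ be linearly independent complex-valued functions on $\mathbb{R}_+=(0,\infty)$ with $\int_{\mathbb{R}_+}(1+x^2)|v_k(x)|^2dx<\infty$ for all $k$. $\langle f,g\rangle=\int_{\mathbb{R}_+}f\overline g\,dx$. Operators: $L_0y=-y''$ in $L^2(\mathbb{R}_+)$ with domain $\{y\in W_2^2(\mathbb{R}_+):y(0)=0\}$; $L_k=L_0+\sum_{s=1}^k\alpha_s\langle\cdot,v_s\rangle v_s$ ($0\le k\le n$); $R_k(z)=(L_k-zI)^{-1}$ for $z\in\mathbb{C}\setminus\mathbb{R}$. Boundary values: for real $\lambda\neq0$, $b_k(\lambda^2)$ in the definition of $r_k(\lambda)$ is understood as the boundary value from the upper half-plane $\lim_{\varepsilon\to+0}b_k((\lambda+i\varepsilon)^2)$; thus $r_k(-\lambda)$ is the value of the same function at the real point $-\lambda$ (it involves $\lim_{\varepsilon\to+0}b_k((-\lambda+i\varepsilon)^2)=\lim_{\varepsilon\to+0}b_k((\lambda-i\varepsilon)^2)$).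 Scattering function: for real $\lambda$ let $\widetilde v_k(\lambda)=\int_{\mathbb{R}_+}e^{-i\lambda x}v_k(x)\,dx$, $\widetilde v_k^*(\lambda)=\overline{\widetilde v_k(\overline\lambda)}$; for real $\lambda\neq0$ let $$\psi_k(\lambda,x)=\int_x^\infty\frac{\sin\lambda(t-x)}{\lambda}v_k(t)\,dt,\qquad \varphi_{s,k}(\lambda)=\int_{\mathbb{R}_+}\psi_s(\lambda,x)\overline{v_k(x)}\,dx.$$ Let $M(\lambda)$ be the $n\times n$ matrix with entry $\alpha_s\varphi_{s,k}(\lambda)-\delta_{s,k}$ in row $k$, column $s$; $e_0(\lambda)=\det M(\lambda)$; $e_j(\lambda)=-\det M_j(\lambda)$, where $M_j(\lambda)$ is $M(\lambda)$ with $j$-th column replaced by $(\widetilde v_1^*(\lambda),\dots,\widetilde v_n^*(\lambda))^T$. The Jost solution is $e(\lambda,x)=e^{i\lambda x}e_0(\lambda)+\sum_{k=1}^n\alpha_ke_k(\lambda)\psi_k(\lambda,x)$, and the scattering function is $S(\lambda)=e(-\lambda,0)/e(\lambda,0)$. *)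

theory Defs
  imports "HOL-Analysis.Analysis" "Jordan_Normal_Form.Determinant"
begin

text \<open>
  A function on the half-line is a total function \<^typ>\<open>real \<Rightarrow> complex\<close> whose values on the
  negative axis are irrelevant. Elements of \<open>L\<^sup>2\<close> are represented by functions; equality
  in \<open>L\<^sup>2\<close> is equality almost everywhere on the half-line.
\<close>

abbreviation half_line :: "real measure" where
  "half_line \<equiv> lebesgue_on {0<..}"

definition L2_fun :: "(real \<Rightarrow> complex) \<Rightarrow> bool" where
  "L2_fun f \<longleftrightarrow> f \<in> borel_measurable half_line \<and> integrable half_line (\<lambda>x. (cmod (f x))\<^sup>2)"

definition L2_ip :: "(real \<Rightarrow> complex) \<Rightarrow> (real \<Rightarrow> complex) \<Rightarrow> complex" where
  "L2_ip f g = (LINT x|half_line. f x * cnj (g x))"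

definition L2_lin_indep :: "nat \<Rightarrow> (nat \<Rightarrow> real \<Rightarrow> complex) \<Rightarrow> bool" where
  "L2_lin_indep n v \<longleftrightarrow>
     (\<forall>c :: nat \<Rightarrow> complex.
        (AE x in half_line. (\<Sum>k=1..n. c k * v k x) = 0) \<longrightarrow> (\<forall>k\<in>{1..n}. c k = 0))"

text \<open>
  \<open>y\<close> belongs to \<open>W\<^sub>2\<^sup>2\<close> of the half-line, with first and second (generalized) derivatives
  \<open>y1\<close> and \<open>y2\<close>: the three functions are square integrable, and \<open>y\<close>, \<open>y1\<close> are locally
  absolutely continuous on the closed half-line, i.e. indefinite integrals of \<open>y1\<close>, \<open>y2\<close>.
  Thus \<open>y\<close> is the continuous representative of its class and \<open>y 0\<close> is its trace at \<open>0\<close>.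
\<close>

definition W22_derivs :: "(real \<Rightarrow> complex) \<Rightarrow> (real \<Rightarrow> complex) \<Rightarrow> (real \<Rightarrow> complex) \<Rightarrow> bool" where
  "W22_derivs y y1 y2 \<longleftrightarrow>
     L2_fun y \<and> L2_fun y1 \<and> L2_fun y2 \<and>
     (\<forall>x\<ge>0. y x = y 0 + (LINT t|lebesgue_on {0<..x}. y1 t)) \<and>
     (\<forall>x\<ge>0. y1 x = y1 0 + (LINT t|lebesgue_on {0<..x}. y2 t))"

definition dom_L :: "(real \<Rightarrow> complex) set" where
  "dom_L = {y. (\<exists>y1 y2. W22_derivs y y1 y2) \<and> y 0 = 0}"

text \<open>The second derivative is determined up to a null set.\<close>

definition second_deriv :: "(real \<Rightarrow> complex) \<Rightarrow> real \<Rightarrow> complex" where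
  "second_deriv y = (SOME y2. \<exists>y1. W22_derivs y y1 y2)"

definition op_L :: "(nat \<Rightarrow> real) \<Rightarrow> (nat \<Rightarrow> real \<Rightarrow> complex) \<Rightarrow> nat \<Rightarrow>
    (real \<Rightarrow> complex) \<Rightarrow> real \<Rightarrow> complex" where
  "op_L \<alpha> v k y = (\<lambda>x. - second_deriv y x + (\<Sum>s=1..k. of_real (\<alpha> s) * L2_ip y (v s) * v s x))"

text \<open>
  \<open>(L\<^sub>k - z I)\<^sup>-\<^sup>1 f\<close>: the element of the domain that \<open>L\<^sub>k - z I\<close> maps to \<open>f\<close>. For non-real \<open>z\<close> and
  square integrable \<open>f\<close> it exists and its values on the closed half-line are unique, since
  \<open>L\<^sub>k\<close> is self-adjoint.
\<close>

definition resolvent_L :: "(nat \<Rightarrow> real) \<Rightarrow> (nat \<Rightarrow> real \<Rightarrow> complex) \<Rightarrow> nat \<Rightarrow> complex \<Rightarrow>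
    (real \<Rightarrow> complex) \<Rightarrow> real \<Rightarrow> complex" where
  "resolvent_L \<alpha> v k z f =
     (SOME y. y \<in> dom_L \<and> (AE x in half_line. op_L \<alpha> v k y x - z * y x = f x))"

definition b_fun :: "(nat \<Rightarrow> real) \<Rightarrow> (nat \<Rightarrow> real \<Rightarrow> complex) \<Rightarrow> nat \<Rightarrow> complex \<Rightarrow> complex" where
  "b_fun \<alpha> v k z = 1 + of_real (\<alpha> k) * L2_ip (resolvent_L \<alpha> v (k - 1) z (v k)) (v k)"

text \<open>
  The boundary value depends on \<open>lam\<close> and not only on \<open>lam\<^sup>2\<close>: for \<open>lam > 0\<close> the point \<open>lam\<^sup>2\<close> is
  approached from the upper half-plane, for \<open>lam < 0\<close> from the lower one.
\<close>

definition b_bv_exists :: "(nat \<Rightarrow> real) \<Rightarrow> (nat \<Rightarrow> real \<Rightarrow> complex) \<Rightarrow> nat \<Rightarrow> real \<Rightarrow> bool" where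
  "b_bv_exists \<alpha> v k lam \<longleftrightarrow>
     (\<exists>b. ((\<lambda>\<epsilon>. b_fun \<alpha> v k ((of_real lam + \<i> * of_real \<epsilon>)\<^sup>2)) \<longlongrightarrow> b) (at_right (0::real)))"

definition b_bv :: "(nat \<Rightarrow> real) \<Rightarrow> (nat \<Rightarrow> real \<Rightarrow> complex) \<Rightarrow> nat \<Rightarrow> real \<Rightarrow> complex" where
  "b_bv \<alpha> v k lam = Lim (at_right (0::real)) (\<lambda>\<epsilon>. b_fun \<alpha> v k ((of_real lam + \<i> * of_real \<epsilon>)\<^sup>2))"

definition r_fun :: "(nat \<Rightarrow> real) \<Rightarrow> (nat \<Rightarrow> real \<Rightarrow> complex) \<Rightarrow> nat \<Rightarrow> real \<Rightarrow> complex" where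
  "r_fun \<alpha> v k lam = - (2 * \<i> * of_real lam / of_real (\<alpha> k)) * b_bv \<alpha> v k lam"

definition S_factor :: "(nat \<Rightarrow> real) \<Rightarrow> (nat \<Rightarrow> real \<Rightarrow> complex) \<Rightarrow> nat \<Rightarrow> real \<Rightarrow> complex" where
  "S_factor \<alpha> v k lam = - (r_fun \<alpha> v k (- lam) / r_fun \<alpha> v k lam)"

definition v_tilde :: "(real \<Rightarrow> complex) \<Rightarrow> real \<Rightarrow> complex" where
  "v_tilde w lam = (LINT x|half_line. exp (- \<i> * of_real lam * of_real x) * w x)"

text \<open>Only real \<open>lam\<close> occur, so the conjugation of the argument is omitted.\<close>

definition v_tilde_star :: "(real \<Rightarrow> complex) \<Rightarrow> real \<Rightarrow> complex" where
  "v_tilde_star w lam = cnj (v_tilde w lam)"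

definition psi :: "(real \<Rightarrow> complex) \<Rightarrow> real \<Rightarrow> real \<Rightarrow> complex" where
  "psi w lam x = (LINT t|lebesgue_on {x<..}. of_real (sin (lam * (t - x)) / lam) * w t)"

definition phi :: "(nat \<Rightarrow> real \<Rightarrow> complex) \<Rightarrow> nat \<Rightarrow> nat \<Rightarrow> real \<Rightarrow> complex" where
  "phi v s k lam = (LINT x|half_line. psi (v s) lam x * cnj (v k x))"

text \<open>
  Rows and columns of \<^const>\<open>mat\<close> are numbered from \<open>0\<close>, whereas \<open>\<alpha>\<close>, \<open>v\<close> and the
  coefficients \<open>e\<^sub>j\<close> are numbered from \<open>1\<close>.
\<close>

definition M_mat :: "nat \<Rightarrow> (nat \<Rightarrow> real) \<Rightarrow> (nat \<Rightarrow> real \<Rightarrow> complex) \<Rightarrow> real \<Rightarrow> complex mat" where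
  "M_mat n \<alpha> v lam = mat n n (\<lambda>(k, s).
     of_real (\<alpha> (s + 1)) * phi v (s + 1) (k + 1) lam - (if s = k then 1 else 0))"

definition e_zero :: "nat \<Rightarrow> (nat \<Rightarrow> real) \<Rightarrow> (nat \<Rightarrow> real \<Rightarrow> complex) \<Rightarrow> real \<Rightarrow> complex" where
  "e_zero n \<alpha> v lam = Determinant.det (M_mat n \<alpha> v lam)"

definition e_coeff :: "nat \<Rightarrow> (nat \<Rightarrow> real) \<Rightarrow> (nat \<Rightarrow> real \<Rightarrow> complex) \<Rightarrow> nat \<Rightarrow> real \<Rightarrow> complex" where
  "e_coeff n \<alpha> v j lam =
     - Determinant.det (replace_col (M_mat n \<alpha> v lam)
          (Matrix.vec n (\<lambda>k. v_tilde_star (v (k + 1)) lam)) (j - 1))"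

definition jost :: "nat \<Rightarrow> (nat \<Rightarrow> real) \<Rightarrow> (nat \<Rightarrow> real \<Rightarrow> complex) \<Rightarrow> real \<Rightarrow> real \<Rightarrow> complex" where
  "jost n \<alpha> v lam x = exp (\<i> * of_real lam * of_real x) * e_zero n \<alpha> v lam
     + (\<Sum>k=1..n. of_real (\<alpha> k) * e_coeff n \<alpha> v k lam * psi (v k) lam x)"

definition scattering :: "nat \<Rightarrow> (nat \<Rightarrow> real) \<Rightarrow> (nat \<Rightarrow> real \<Rightarrow> complex) \<Rightarrow> real \<Rightarrow> complex" where
  "scattering n \<alpha> v lam = jost n \<alpha> v (- lam) 0 / jost n \<alpha> v lam 0"

end

theory Submission
  imports Defs
begin

text \<open>
  For \<open>Im \<kappa> > 0\<close> the resolvent \<open>R\<^sub>0(\<kappa>\<^sup>2)\<close> is the integral operator \<open>green_op \<kappa>\<close> with the Green kernel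
  \<open>green \<kappa>\<close>. Let \<open>D\<^sub>k(\<kappa>)\<close> be the determinant of order \<open>k\<close> with entries \<open>\<delta> + \<alpha>\<^sub>s \<langle>R\<^sub>0(\<kappa>\<^sup>2) v\<^sub>s, v\<^sub>j\<rangle>\<close>.
  Since \<open>R\<^sub>k\<^sub>-\<^sub>1 v\<^sub>k\<close> is \<open>R\<^sub>0\<close> applied to a combination of \<open>v\<^sub>1, \<dots>, v\<^sub>k\<close>, a column operation gives
  \<open>D\<^sub>k = b\<^sub>k D\<^sub>k\<^sub>-\<^sub>1\<close> and hence \<open>D\<^sub>n = b\<^sub>1 \<cdots> b\<^sub>n\<close>, as long as no \<open>D\<^sub>k\<close> vanishes. Near \<open>lam\<close> this follows from
  \<open>b\<^sub>k \<noteq> 0\<close>, and near \<open>- lam\<close> from \<open>D\<^sub>k(- cnj \<kappa>) = cnj (D\<^sub>k(\<kappa>))\<close>. At real \<open>lam \<noteq> 0\<close> the Green kernel differs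
  from the kernel of \<open>- \<psi>\<close> by a term of rank one, so the rank-one update formula for determinants
  identifies \<open>e(lam, 0)\<close> with the boundary value \<open>(- 1)\<^sup>n D\<^sub>n(lam)\<close>. The factors \<open>b\<^sub>k(- lam) / b\<^sub>k(lam)\<close> are
  the \<open>S\<^sub>k(lam)\<close>.
\<close>

subsection \<open>Determinants\<close>

text \<open>The columns are updated one at a time, and each update contributes one term linear in
  \<open>w\<close>. Terms of higher order vanish because they come from determinants with two
  columns proportional to \<open>u\<close>. No inverse of \<open>M\<close> enters, so singular
  \<open>M\<close> is covered.\<close>

lemma det_rank_one_update:
  fixes M :: "'a :: idom mat"
  assumes M: "M \<in> carrier_mat n n"
  shows "Determinant.det (mat n n (\<lambda>(i, j). M $$ (i, j) - u i * w j)) =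
    Determinant.det M - (\<Sum>j<n. w j * Determinant.det (replace_col M (Matrix.vec n u) j))"
proof -
  \<comment> \<open>\<open>P m\<close> carries the update in the columns below \<open>m\<close>
    only; it interpolates between \<open>M\<close> and the fully updated matrix.\<close>
  define P where "P m = mat n n (\<lambda>(i, j). M $$ (i, j) - (if j < m then u i * w j else 0))" for m
  have P[simp]: "P m \<in> carrier_mat n n" "dim_row (P m) = n" "dim_col (P m) = n" for m
    by (simp_all add: P_def)
  have P_index: "P m $$ (i, j) = M $$ (i, j) - (if j < m then u i * w j else 0)"
    if "i < n" "j < n" for m i j
    using that by (simp add: P_def)
  have "Determinant.det (P m) =
      Determinant.det M - (\<Sum>j<m. w j * Determinant.det (replace_col M (Matrix.vec n u) j))"
    if "m \<le> n" for m
    using that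
  proof (induction m)
    case 0
    have "P 0 = M"
      using M by (intro eq_matI) (auto simp: P_def)
    then show ?case by simp
  next
    case (Suc m)
    then have m: "m < n" by simp
    \<comment> \<open>\<open>R\<close> and \<open>R'\<close> have \<open>u\<close> in column
      \<open>m\<close> and differ only by multiples of \<open>u\<close> in the columns before it.
      Hence \<open>R = R' * E\<close> with a unit lower triangular \<open>E\<close>, and both have
      the same determinant.\<close>
    define R where "R = replace_col (P m) (Matrix.vec n u) m"
    define R' where "R' = replace_col M (Matrix.vec n u) m"
    define E where "E = mat n n (\<lambda>(k, j). (if k = j then 1 else 0) - (if k = m \<and> j < m then w j else 0))"
    have R: "R \<in> carrier_mat n n" and R': "R' \<in> carrier_mat n n" and E: "E \<in> carrier_mat n n"
      using M by (auto simp: R_def R'_def E_def replace_col_def)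
    \<comment> \<open>\<open>P (Suc m)\<close>, \<open>P m\<close> and \<open>R\<close> differ only
      in column \<open>m\<close>, so they share the cofactors along it, and Laplace expansion there
      expresses linearity in that column.\<close>
    have "mat_delete (P (Suc m)) i m = mat_delete (P m) i m"
      and "mat_delete R i m = mat_delete (P m) i m" if "i < n" for i
      by (rule eq_matI; use m that in \<open>auto simp: mat_delete_def P_index R_def replace_col_def\<close>)+
    then have cof: "cofactor (P (Suc m)) i m = cofactor (P m) i m"
      and cof': "cofactor R i m = cofactor (P m) i m" if "i < n" for i
      using that by (simp_all add: cofactor_def)
    have R_exp: "(\<Sum>i<n. R $$ (i, m) * cofactor R i m) = (\<Sum>i<n. u i * cofactor (P m) i m)"
      using m by (intro sum.cong) (auto simp: cof', simp add: R_def replace_col_def)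
    have "Determinant.det (P (Suc m)) = (\<Sum>i<n. P (Suc m) $$ (i, m) * cofactor (P m) i m)"
      using m by (simp add: laplace_expansion_column[OF P(1) m] cof)
    also have "\<dots> = (\<Sum>i<n. P m $$ (i, m) * cofactor (P m) i m) - w m * (\<Sum>i<n. R $$ (i, m) * cofactor R i m)"
      using m unfolding R_exp by (simp add: P_index algebra_simps sum_subtractf sum_distrib_left)
    also have "\<dots> = Determinant.det (P m) - w m * Determinant.det R"
      using laplace_expansion_column[OF P(1) m] laplace_expansion_column[OF R m] by simp
    also have "R = R' * E"
    proof (rule eq_matI)
      fix i j assume ij: "i < dim_row (R' * E)" "j < dim_col (R' * E)"
      then have i: "i < n" and j: "j < n" using R' E by auto
      have "(R' * E) $$ (i, j) = (\<Sum>k = 0..<n. R' $$ (i, k) * E $$ (k, j))"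
        using i j R' E by (simp add: scalar_prod_def)
      also have "\<dots> = (\<Sum>k = 0..<n. (if k = j then R' $$ (i, k) else 0) -
          (if k = m then (if j < m then R' $$ (i, k) * w j else 0) else 0))"
        using j by (intro sum.cong) (auto simp: E_def algebra_simps)
      also have "\<dots> = R' $$ (i, j) - (if j < m then R' $$ (i, m) * w j else 0)"
        using j m by (simp add: sum_subtractf)
      also have "\<dots> = R $$ (i, j)"
        using i j m M by (auto simp: R_def R'_def replace_col_def P_index)
      finally show "R $$ (i, j) = (R' * E) $$ (i, j)" ..
    qed (use R R' E in auto)
    also have "Determinant.det (R' * E) = Determinant.det R'"
    proof -
      have "Determinant.det E = prod_list (diag_mat E)"
        by (rule det_lower_triangular[OF _ E]) (auto simp: E_def)
      also have "diag_mat E = replicate n 1"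
        by (rule nth_equalityI) (auto simp: diag_mat_def E_def)
      finally show ?thesis using det_mult[OF R' E] by simp
    qed
    finally show ?case
      using Suc by (simp add: R'_def algebra_simps)
  qed
  moreover have "P n = mat n n (\<lambda>(i, j). M $$ (i, j) - u i * w j)"
    by (auto simp: P_def)
  ultimately show ?thesis by (metis order_refl)
qed

text \<open>Subtracting from the last column the combination of the others with coefficients
  \<open>x\<close> clears it except for the corner, which becomes the Schur complement; expansion
  along that column finishes.\<close>

lemma det_border:
  fixes a :: "nat \<Rightarrow> nat \<Rightarrow> 'a :: idom"
  assumes x: "\<And>i. i < m \<Longrightarrow> a i m = (\<Sum>s<m. a i s * x s)"
  shows "Determinant.det (mat (Suc m) (Suc m) (\<lambda>(i, j). a i j)) =
    (a m m - (\<Sum>s<m. a m s * x s)) * Determinant.det (mat m m (\<lambda>(i, j). a i j))"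
proof -
  define A where "A = mat (Suc m) (Suc m) (\<lambda>(i, j). a i j)"
  \<comment> \<open>Right multiplication by this unit upper triangular matrix performs the column
    operation.\<close>
  define E where "E = mat (Suc m) (Suc m) (\<lambda>(k, j). (if k = j then 1 else 0) - (if k < m \<and> j = m then x k else 0))"
  have A: "A \<in> carrier_mat (Suc m) (Suc m)" and E: "E \<in> carrier_mat (Suc m) (Suc m)"
    by (auto simp: A_def E_def)
  have AE: "A * E \<in> carrier_mat (Suc m) (Suc m)" using A E by auto
  have "Determinant.det E = prod_list (diag_mat E)"
    by (rule det_upper_triangular[OF _ E]) (auto simp: E_def)
  also have "diag_mat E = replicate (Suc m) 1"
    by (rule nth_equalityI) (auto simp add: diag_mat_def E_def simp del: upt_Suc replicate_Suc)
  finally have "Determinant.det A = Determinant.det (A * E)"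
    using det_mult[OF A E] by simp
  also have "\<dots> = (\<Sum>i<Suc m. (A * E) $$ (i, m) * cofactor (A * E) i m)"
    by (rule laplace_expansion_column[OF AE]) simp
  also have "\<dots> = (\<Sum>i<Suc m. (if i = m then (a m m - (\<Sum>s<m. a m s * x s)) * cofactor (A * E) i m else 0))"
  proof (rule sum.cong[OF refl])
    fix i assume i: "i \<in> {..<Suc m}"
    have "(A * E) $$ (i, m) = (\<Sum>k = 0..<Suc m. A $$ (i, k) * E $$ (k, m))"
      using i A E by (simp add: scalar_prod_def)
    also have "\<dots> = a i m - (\<Sum>s<m. a i s * x s)"
      using i by (simp add: A_def E_def lessThan_atLeast0 sum_negf)
    finally show "(A * E) $$ (i, m) * cofactor (A * E) i m =
        (if i = m then (a m m - (\<Sum>s<m. a m s * x s)) * cofactor (A * E) i m else 0)"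
      using x[of i] i by auto
  qed
  also have "\<dots> = (a m m - (\<Sum>s<m. a m s * x s)) * Determinant.det (mat_delete (A * E) m m)"
    by (simp add: cofactor_def)
  also have "mat_delete (A * E) m m = mat m m (\<lambda>(i, j). a i j)"
  proof (rule eq_matI)
    fix i j assume ij: "i < dim_row (mat m m (\<lambda>(i, j). a i j))" "j < dim_col (mat m m (\<lambda>(i, j). a i j))"
    then have "mat_delete (A * E) m m $$ (i, j) = (A * E) $$ (i, j)"
      using A E by (simp add: mat_delete_def)
    also have "\<dots> = (\<Sum>k = 0..<Suc m. A $$ (i, k) * E $$ (k, j))"
      using ij A E by (simp add: scalar_prod_def)
    also have "\<dots> = (\<Sum>k = 0..<Suc m. if k = j then a i k else 0)"
      using ij by (intro sum.cong) (auto simp: A_def E_def)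
    finally show "mat_delete (A * E) m m $$ (i, j) = mat m m (\<lambda>(i, j). a i j) $$ (i, j)"
      using ij by simp
  qed (use A E in \<open>auto simp: mat_delete_def\<close>)
  finally show ?thesis by (simp add: A_def)
qed

text \<open>Here \<open>b\<close> is the adjoint of \<open>a\<close> conjugated by the diagonal
  matrix of \<open>d\<close>. In the Leibniz formula the factors \<open>d (p i) / d i\<close>
  multiply to 1 along every permutation, and transposition does not change the determinant.\<close>

lemma det_conj_similar:
  fixes a :: "nat \<Rightarrow> nat \<Rightarrow> complex" and d :: "nat \<Rightarrow> complex"
  assumes "\<And>i. i < n \<Longrightarrow> d i \<noteq> 0" 
    and b: "\<And>i j. i < n \<Longrightarrow> j < n \<Longrightarrow> b i j = cnj (a j i) * d j / d i"
  shows "Determinant.det (mat n n (\<lambda>(i, j). b i j)) = cnj (Determinant.det (mat n n (\<lambda>(i, j). a i j)))"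
proof -
  have "Determinant.det (mat n n (\<lambda>(i, j). b i j)) =
      (\<Sum>p | p permutes {0..<n}. signof p * (\<Prod>i = 0..<n. b i (p i)))"
    by (subst det_def'[of _ n]) (auto intro!: sum.cong prod.cong dest: permutes_in_image)
  also have "\<dots> = (\<Sum>p | p permutes {0..<n}. signof p * (\<Prod>i = 0..<n. cnj (a (p i) i)))"
  proof (intro sum.cong refl arg_cong[where f = "\<lambda>x. _ * x"])
    fix p assume "p \<in> {p. p permutes {0..<n}}"
    then have p: "p permutes {0..<n}" by simp
    have "(\<Prod>i = 0..<n. b i (p i)) = (\<Prod>i = 0..<n. cnj (a (p i) i) * d (p i) / d i)"
      using permutes_in_image[OF p] by (intro prod.cong) (auto simp: b)
    also have "\<dots> = (\<Prod>i = 0..<n. cnj (a (p i) i)) * ((\<Prod>i = 0..<n. d (p i)) / (\<Prod>i = 0..<n. d i))"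
      by (simp add: prod.distrib prod_dividef)
    also have "(\<Prod>i = 0..<n. d (p i)) = (\<Prod>i = 0..<n. d i)"
      using prod.permute[OF p, of d] by (simp add: o_def)
    also have "(\<Prod>i = 0..<n. d i) / (\<Prod>i = 0..<n. d i) = 1"
      using assms(1) by simp
    finally show "(\<Prod>i = 0..<n. b i (p i)) = (\<Prod>i = 0..<n. cnj (a (p i) i))" by simp
  qed
  also have "\<dots> = cnj (\<Sum>p | p permutes {0..<n}. signof p * (\<Prod>i = 0..<n. a (p i) i))"
    by (auto intro!: sum.cong simp: sign_def)
  also have "(\<Sum>p | p permutes {0..<n}. signof p * (\<Prod>i = 0..<n. a (p i) i)) =
      Determinant.det (mat n n (\<lambda>(i, j). a i j))"
    by (subst det_col[of _ n])
       (auto intro!: sum.cong prod.cong dest: permutes_in_image simp: lessThan_atLeast0)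
  finally show ?thesis .
qed

lemma tendsto_det:
  fixes a :: "'b \<Rightarrow> nat \<Rightarrow> nat \<Rightarrow> complex"
  assumes "\<And>i j. i < n \<Longrightarrow> j < n \<Longrightarrow> ((\<lambda>e. a e i j) \<longlongrightarrow> b i j) F"
  shows "((\<lambda>e. Determinant.det (mat n n (\<lambda>(i, j). a e i j))) \<longlongrightarrow>
    Determinant.det (mat n n (\<lambda>(i, j). b i j))) F"
proof -
  have eq: "Determinant.det (mat n n (\<lambda>(i, j). c i j)) =
      (\<Sum>p | p permutes {0..<n}. signof p * (\<Prod>i = 0..<n. c i (p i)))" for c :: "nat \<Rightarrow> nat \<Rightarrow> complex"
    by (subst det_def'[of _ n]) (auto intro!: sum.cong prod.cong dest: permutes_in_image)
  show ?thesis
    unfolding eq using assms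
    by (intro tendsto_intros) (auto dest: permutes_in_image)
qed

lemma det_nonzero_solve:
  fixes a :: "nat \<Rightarrow> nat \<Rightarrow> 'a :: field"
  assumes "Determinant.det (mat n n (\<lambda>(i, j). a i j)) \<noteq> 0"
  obtains x where "\<And>i. i < n \<Longrightarrow> (\<Sum>s<n. a i s * x s) = c i"
proof -
  define A where "A = mat n n (\<lambda>(i, j). a i j)"
  have A: "A \<in> carrier_mat n n" by (simp add: A_def)
  have "Determinant.det A \<noteq> 0" using assms by (simp add: A_def)
  from det_non_zero_imp_unit[OF A this, of "()"]
  obtain B where B: "B \<in> carrier_mat n n" "A * B = 1\<^sub>m n"
    unfolding Units_def ring_mat_def by auto
  define y where "y = B *\<^sub>v Matrix.vec n c"
  have "A *\<^sub>v y = Matrix.vec n c"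
    unfolding y_def using A B by (subst assoc_mult_mat_vec[symmetric, of _ n n _ n]) auto
  then have "(A *\<^sub>v y) $ i = c i" if "i < n" for i
    using that by simp
  then have "(\<Sum>s<n. a i s * y $ s) = c i" if "i < n" for i
    using that A B by (simp add: A_def y_def scalar_prod_def lessThan_atLeast0)
  then show thesis by (rule that)
qed

subsection \<open>Square-integrable functions on the half-line\<close>

lemma sigma_finite_lebesgue_on:
  fixes S :: "'a :: euclidean_space set"
  assumes "S \<in> sets lebesgue"
  shows "sigma_finite_measure (lebesgue_on S)"
proof (rule sigma_finite_measure_restrict_space[OF _ assms])
  obtain A :: "'a set set" where "countable A" "A \<subseteq> sets lborel" "\<Union>A = space lborel" "\<forall>a\<in>A. emeasure lborel a \<noteq> \<infinity>"
    using lborel.sigma_finite_countable by blast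
  then show "sigma_finite_measure (lebesgue :: 'a measure)"
    by (intro sigma_finite_measure.intro exI[of _ A]) auto
qed

lemma measurable_ident_lebesgue_on [measurable]:
  "(\<lambda>x. x) \<in> borel_measurable (lebesgue_on (S :: 'a :: euclidean_space set))"
  by (rule measurable_restrict_space1) (simp add: measurable_completion)

lemma pair_sigma_finite_lebesgue_on:
  "S \<in> sets lebesgue \<Longrightarrow> T \<in> sets lebesgue \<Longrightarrow>
    pair_sigma_finite (lebesgue_on (S :: real set)) (lebesgue_on (T :: real set))"
  by (simp add: pair_sigma_finite_def sigma_finite_lebesgue_on)

lemma integrable_half_line_Ioc:
  fixes f :: "real \<Rightarrow> 'b :: {banach, second_countable_topology}"
  assumes "integrable half_line f" 
  shows "integrable (lebesgue_on {0<..x}) f"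
proof -
  have eq: "restrict_space half_line {0<..x} = lebesgue_on {0<..x}"
    by (subst restrict_restrict_space) (auto intro!: arg_cong[where f = "restrict_space lebesgue"])
  show ?thesis unfolding eq[symmetric]
    using assms
    by (subst integrable_restrict_space)
      (auto intro!: integrable_mult_indicator simp: space_restrict_space sets_restrict_space intro!: image_eqI[of _ _ "{0<..x}"])
qed

text \<open>Bridge to the gauge integral over the closed interval, for which the fundamental theorem
  of calculus is available; the left endpoint is negligible.\<close>

lemma lebesgue_on_Ioc_integral:
  fixes f :: "real \<Rightarrow> complex"
  assumes f: "integrable (lebesgue_on {a<..b}) f" 
  shows "f integrable_on {a..b}" "integral\<^sup>L (lebesgue_on {a<..b}) f = integral {a..b} f"
proof -
  have neg: "negligible ({a..b} - {a<..b})"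
    by (rule negligible_subset[of "{a}"]) auto
  have "f integrable_on {a<..b}"
    using f by (intro integrable_on_lebesgue_on) auto
  then show "f integrable_on {a..b}"
    by (rule integrable_spike_set) (auto intro: negligible_subset[OF neg])
  have "integral {a<..b} f = integral {a..b} f"
    by (rule integral_spike_set) (auto intro: negligible_subset[OF neg])
  then show "integral\<^sup>L (lebesgue_on {a<..b}) f = integral {a..b} f"
    using f by (subst lebesgue_integral_eq_integral) auto
qed

lemma integrable_prod_mult:
  fixes f :: "'a \<Rightarrow> complex" and g :: "'b \<Rightarrow> complex"
  assumes "pair_sigma_finite M1 M2" and f: "integrable M1 f" and g: "integrable M2 g"
  shows "integrable (M1 \<Otimes>\<^sub>M M2) (\<lambda>(x, y). f x * g y)"
proof -
  interpret pair_sigma_finite M1 M2 by fact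
  have [measurable]: "f \<in> borel_measurable M1" "g \<in> borel_measurable M2"
    using f g by auto
  show ?thesis
    using f g by (intro Fubini_integrable) (auto simp: norm_mult)
qed

text \<open>Working class for the \<open>v k\<close>: square integrability is needed for the domain
  of the operators, integrability for bounds that persist when \<kappa> reaches the real
  axis.\<close>

definition L12_fun :: "(real \<Rightarrow> complex) \<Rightarrow> bool" where
  "L12_fun f \<longleftrightarrow> integrable half_line f \<and> integrable half_line (\<lambda>x. (cmod (f x))\<^sup>2)"

lemma L12_fun_L2: "L12_fun f \<Longrightarrow> L2_fun f"
  by (auto simp: L12_fun_def L2_fun_def)

lemma norm_add_square_le: "(norm (x + y))\<^sup>2 \<le> 2 * (norm x)\<^sup>2 + 2 * (norm (y :: complex))\<^sup>2"
proof -
  have "(norm (x + y))\<^sup>2 \<le> (norm x + norm y)\<^sup>2"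
    by (intro power_mono norm_triangle_ineq) auto
  also have "\<dots> \<le> 2 * (norm x)\<^sup>2 + 2 * (norm y)\<^sup>2"
    using sum_squares_bound[of "norm x" "norm y"] by (simp add: power2_sum)
  finally show ?thesis .
qed

lemma L2_fun_add:
  assumes f: "L2_fun f" and g: "L2_fun g"
  shows "L2_fun (\<lambda>x. f x + g x)"
proof -
  have [measurable]: "f \<in> borel_measurable half_line" "g \<in> borel_measurable half_line"
    using f g by (auto simp: L2_fun_def)
  have "integrable half_line (\<lambda>x. (cmod (f x + g x))\<^sup>2)"
  proof (rule Bochner_Integration.integrable_bound)
    show "integrable half_line (\<lambda>x. 2 * (cmod (f x))\<^sup>2 + 2 * (cmod (g x))\<^sup>2)"
      using f g by (simp add: L2_fun_def)
    show "AE x in half_line. norm ((cmod (f x + g x))\<^sup>2) \<le> norm (2 * (cmod (f x))\<^sup>2 + 2 * (cmod (g x))\<^sup>2)"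
      using norm_add_square_le by (intro always_eventually) simp
  qed measurable
  then show ?thesis by (simp add: L2_fun_def)
qed

lemma L2_fun_cmult: "L2_fun f \<Longrightarrow> L2_fun (\<lambda>x. c * f x)"
  unfolding L2_fun_def by (auto simp: norm_mult power_mult_distrib intro!: borel_measurable_times)

lemma L2_fun_diff: "L2_fun f \<Longrightarrow> L2_fun g \<Longrightarrow> L2_fun (\<lambda>x. f x - g x)"
  using L2_fun_add[of f "\<lambda>x. (-1) * g x"] L2_fun_cmult[of g "-1"] by simp

lemma L12_fun_diff: "L12_fun f \<Longrightarrow> L12_fun g \<Longrightarrow> L12_fun (\<lambda>x. f x - g x)"
  using L2_fun_diff[of f g] by (auto simp: L12_fun_def L2_fun_def)

lemma L12_fun_sum:
  assumes "\<And>s. s \<in> A \<Longrightarrow> L12_fun (f s)"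
  shows "L12_fun (\<lambda>x. \<Sum>s\<in>A. c s * f s x)"
proof -
  have "L2_fun (\<lambda>x. \<Sum>s\<in>A. c s * f s x)"
  proof (cases "finite A")
    case True
    then show ?thesis using assms
      by (induction A) (auto simp: L2_fun_add L2_fun_cmult L12_fun_L2, simp add: L2_fun_def)
  qed (simp add: L2_fun_def)
  then show ?thesis
    using assms by (auto simp: L12_fun_def L2_fun_def)
qed

lemma L2_fun_integrable_Ioc:
  assumes "L2_fun f" 
  shows "integrable (lebesgue_on {0<..x}) f"
proof (rule Bochner_Integration.integrable_bound)
  show "integrable (lebesgue_on {0<..x}) (\<lambda>x. 1 + (cmod (f x))\<^sup>2)"
  proof (rule Bochner_Integration.integrable_add)
    show "integrable (lebesgue_on {0<..x}) (\<lambda>x. 1 :: real)"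
      by (intro finite_measure.integrable_const finite_measure_lebesgue_on bounded_set_imp_lmeasurable) auto
    show "integrable (lebesgue_on {0<..x}) (\<lambda>x. (cmod (f x))\<^sup>2)"
      using assms by (intro integrable_half_line_Ioc) (simp add: L2_fun_def)
  qed
  show "f \<in> borel_measurable (lebesgue_on {0<..x})"
  proof (rule measurable_restrict_mono)
    show "f \<in> borel_measurable (lebesgue_on {0<..})" using assms by (simp add: L2_fun_def)
  qed auto
  have "norm (f t) \<le> 1 + (cmod (f t))\<^sup>2" for t
    using sum_squares_bound[of 1 "norm (f t)"] norm_ge_zero[of "f t"] by (simp add: algebra_simps, linarith)
  then show "AE t in lebesgue_on {0<..x}. norm (f t) \<le> norm (1 + (cmod (f t))\<^sup>2)"
    by auto
qed

text \<open>AM--GM against the integrable weight \<open>1 / (1 + x\<^sup>2)\<close>.\<close>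

lemma weighted_L12:
  assumes meas: "f \<in> borel_measurable half_line"
    and int: "integrable half_line (\<lambda>x. (1 + x\<^sup>2) * (cmod (f x))\<^sup>2)"
  shows "L12_fun f"
proof -
  have w: "integrable half_line (\<lambda>x::real. inverse (1 + x\<^sup>2))"
  proof -
    have "((\<lambda>x::real. inverse (1 + x\<^sup>2)) has_integral (pi / 2 - arctan 0)) {0..}"
    proof (rule has_integral_to_inf)
      fix y :: real
      show "(\<lambda>x. inverse (1 + x\<^sup>2)) integrable_on {0..y}"
        by (intro integrable_continuous_interval continuous_intros) (auto simp: add_nonneg_eq_0_iff)
    next
      have "integral {0..y} (\<lambda>x::real. inverse (1 + x\<^sup>2)) = arctan y - arctan 0" if "y \<ge> 0" for y
        using that by (intro integral_unique fundamental_theorem_of_calculus)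
          (auto intro!: derivative_eq_intros simp: has_real_derivative_iff_has_vector_derivative[symmetric])
      then have "\<forall>\<^sub>F y in at_top. arctan y - arctan 0 = integral {0..y} (\<lambda>x::real. inverse (1 + x\<^sup>2))"
        by (auto intro: eventually_mono[OF eventually_ge_at_top[of 0]])
      then show "((\<lambda>y. integral {0..y} (\<lambda>x::real. inverse (1 + x\<^sup>2))) \<longlongrightarrow> pi / 2 - arctan 0) at_top"
        by (rule Lim_transform_eventually[rotated]) (intro tendsto_intros tendsto_arctan_at_top)
    qed auto
    then have "(\<lambda>x::real. inverse (1 + x\<^sup>2)) integrable_on {0<..}"
      by (intro integrable_spike_set[of _ "{0..}" "{0<..}"])
        (auto simp: has_integral_iff intro: negligible_subset[of "{0}"])
    then have "(\<lambda>x::real. inverse (1 + x\<^sup>2)) absolutely_integrable_on {0<..}"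
      by (intro nonnegative_absolutely_integrable_1) (auto simp: add_nonneg_nonneg)
    then show ?thesis
      by (simp add: set_integrable_def integrable_restrict_space)
  qed
  have "integrable half_line f"
  proof (rule Bochner_Integration.integrable_bound)
    show "integrable half_line (\<lambda>x. inverse (1 + x\<^sup>2) + (1 + x\<^sup>2) * (cmod (f x))\<^sup>2)"
      using w int by (rule Bochner_Integration.integrable_add)
    have "cmod (f x) \<le> inverse (1 + x\<^sup>2) + (1 + x\<^sup>2) * (cmod (f x))\<^sup>2" for x
    proof -
      define w where "w = 1 + x\<^sup>2"
      have w: "w > 0" by (simp add: w_def add_pos_nonneg)
      have "0 \<le> (1 - w * cmod (f x))\<^sup>2 / w + cmod (f x)"
        using w by simp
      also have "\<dots> = inverse w + w * (cmod (f x))\<^sup>2 - cmod (f x)"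
        using w by (simp add: power2_eq_square field_simps)
      finally show ?thesis by (simp add: w_def)
    qed
    then show "AE x in half_line. cmod (f x) \<le> norm (inverse (1 + x\<^sup>2) + (1 + x\<^sup>2) * (cmod (f x))\<^sup>2)"
      by (simp add: add_nonneg_nonneg)
  qed (fact meas)
  moreover have "integrable half_line (\<lambda>x. (cmod (f x))\<^sup>2)"
  proof (rule Bochner_Integration.integrable_bound[OF int])
    show "AE x in half_line. norm ((cmod (f x))\<^sup>2) \<le> norm ((1 + x\<^sup>2) * (cmod (f x))\<^sup>2)"
      by (auto simp: abs_mult mult_le_cancel_right1)
  qed (use meas in simp)
  ultimately show ?thesis by (simp add: L12_fun_def)
qed

text \<open>Lebesgue differentiation: almost everywhere \<open>f\<close> is the limit of its
  averages over \<open>[x, x + h]\<close>, and these averages all vanish.\<close>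

lemma AE_zero_of_Ioc_integrals:
  assumes f: "L2_fun f" and zero: "\<And>x. x \<ge> 0 \<Longrightarrow> (LINT t|lebesgue_on {0<..x}. f t) = 0"
  shows "AE x in half_line. f x = 0"
proof -
  \<comment> \<open>Extension by zero, because the differentiation theorem is applied to a function
    integrable on every box of the real line.\<close>
  define F where "F x = (if x \<in> {0<..} then f x else 0)" for x :: real
  have int0: "f integrable_on {0..b}" "integral {0..b} f = 0" if "b \<ge> 0" for b
    using lebesgue_on_Ioc_integral[OF L2_fun_integrable_Ioc[OF f, of b]] zero[OF that] by auto
  have intF: "F integrable_on cbox a b" for a b :: real
  proof -
    have "f integrable_on {0..\<bar>b\<bar>}" by (simp add: int0)
    then have "F integrable_on {0..\<bar>b\<bar>}"
      by (rule integrable_spike_finite[of "{0}", rotated 2]) (auto simp: F_def)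
    moreover have "F integrable_on {- \<bar>a\<bar>..0}"
      by (rule integrable_eq[of "\<lambda>_. 0"]) (auto simp: F_def)
    ultimately have "F integrable_on {- \<bar>a\<bar>..\<bar>b\<bar>}"
      using Henstock_Kurzweil_Integration.integrable_combine[where f = F and a = "- \<bar>a\<bar>" and c = 0 and b = "\<bar>b\<bar>"] by auto
    then show ?thesis
      unfolding box_real by (rule integrable_subinterval_real) auto
  qed
  obtain N where N: "negligible N" and
    d: "\<And>x e. x \<notin> N \<Longrightarrow> 0 < e \<Longrightarrow> \<exists>d>0. \<forall>h. 0 < h \<and> h < d \<longrightarrow>
          norm (integral (cbox x (x + h *\<^sub>R One)) F /\<^sub>R h ^ DIM(real) - F x) < e"
    using integrable_ccontinuous_explicit[OF intF] by metis
  have "f x = 0" if x: "x > 0" "x \<notin> N" for x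
  proof (rule ccontr)
    assume "f x \<noteq> 0"
    \<comment> \<open>The tolerance is \<open>norm (f x)\<close>: a vanishing average has exactly
      this distance from \<open>F x\<close>, so it cannot be closer.\<close>
    then obtain d where "d > 0" and d: "\<And>h. 0 < h \<Longrightarrow> h < d \<Longrightarrow>
        norm (integral (cbox x (x + h *\<^sub>R One)) F /\<^sub>R h ^ DIM(real) - F x) < norm (f x)"
      using d[of x "norm (f x)"] x by auto
    define h where "h = d / 2"
    have h: "0 < h" "h < d" using \<open>d > 0\<close> by (auto simp: h_def)
    have "integral {0..x} f + integral {x..x + h} f = integral {0..x + h} f"
      using x h by (intro Henstock_Kurzweil_Integration.integral_combine int0) auto
    then have "integral {x..x + h} f = 0"
      using x h by (simp add: int0)
    moreover have "integral {x..x + h} f = integral {x..x + h} F"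
      using x by (intro Henstock_Kurzweil_Integration.integral_cong) (auto simp: F_def)
    ultimately show False
      using d[OF h] x by (simp add: F_def)
  qed
  then have "AE x in lebesgue. x > 0 \<longrightarrow> f x = 0"
    using N by (auto simp: eventually_ae_filter_negligible)
  then show ?thesis
    by (simp add: AE_restrict_space_iff)
qed

subsection \<open>The Green kernel\<close>

text \<open>For nonnegative \<open>x\<close>, \<open>t\<close> this is sin(\<kappa> min(x,t)) exp(i
  \<kappa> max(x,t)) / \<kappa>, the free kernel minus its mirror image, which enforces the
  Dirichlet condition at 0. The formula also makes sense for real nonzero \<kappa>.\<close>

definition green :: "complex \<Rightarrow> real \<Rightarrow> real \<Rightarrow> complex" where
  "green \<kappa> x t = \<i> / (2 * \<kappa>) * (exp (\<i> * \<kappa> * of_real \<bar>x - t\<bar>) - exp (\<i> * \<kappa> * of_real (x + t)))"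

text \<open>The derivative of \<open>green\<close> in \<open>x\<close> off the diagonal. It drops by
  1 as \<open>x\<close> increases through \<open>t\<close>; the value on the diagonal is the
  right-hand one.\<close>

definition green_dx :: "complex \<Rightarrow> real \<Rightarrow> real \<Rightarrow> complex" where
  "green_dx \<kappa> x t = - (1 / 2) *
     ((if t \<le> x then 1 else - 1) * exp (\<i> * \<kappa> * of_real \<bar>x - t\<bar>) - exp (\<i> * \<kappa> * of_real (x + t)))"

definition green_op :: "complex \<Rightarrow> (real \<Rightarrow> complex) \<Rightarrow> real \<Rightarrow> complex" where
  "green_op \<kappa> f x = (LINT t|half_line. green \<kappa> x t * f t)"

definition green_op_dx :: "complex \<Rightarrow> (real \<Rightarrow> complex) \<Rightarrow> real \<Rightarrow> complex" where
  "green_op_dx \<kappa> f x = (LINT t|half_line. green_dx \<kappa> x t * f t)"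

lemma measurable_fst_lebesgue_on [measurable]:
  "(\<lambda>p. fst p) \<in> borel_measurable (lebesgue_on (S :: 'a :: euclidean_space set) \<Otimes>\<^sub>M N)"
  by (rule measurable_compose[OF measurable_fst measurable_ident_lebesgue_on])

lemma measurable_snd_lebesgue_on [measurable]:
  "(\<lambda>p. snd p) \<in> borel_measurable (N \<Otimes>\<^sub>M lebesgue_on (S :: 'a :: euclidean_space set))"
  by (rule measurable_compose[OF measurable_snd measurable_ident_lebesgue_on])

lemma borel_measurable_green [measurable (raw)]:
  assumes [measurable]: "f \<in> borel_measurable M" "g \<in> borel_measurable M"
  shows "(\<lambda>x. green \<kappa> (f x) (g x)) \<in> borel_measurable M"
  unfolding green_def by measurable

lemma borel_measurable_green_dx [measurable (raw)]:
  assumes [measurable]: "f \<in> borel_measurable M" "g \<in> borel_measurable M"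
  shows "(\<lambda>x. green_dx \<kappa> (f x) (g x)) \<in> borel_measurable M"
  unfolding green_dx_def by measurable

lemma norm_exp_ii: "cmod (exp (\<i> * \<kappa> * of_real s)) = exp (- Im \<kappa> * s)"
  by simp

lemma green_zero [simp]: "0 < t \<Longrightarrow> green \<kappa> 0 t = 0"
  by (simp add: green_def)

text \<open>The mirror exponential is the smaller one, since \<open>x + t\<close> dominates
  \<open>\<bar>x - t\<bar>\<close>. The case \<open>Im \<kappa> = 0\<close> is included because the
  boundary values need it.\<close>

lemma norm_green_le:
  assumes "0 \<le> x" "0 \<le> t" "0 \<le> Im \<kappa>"
  shows "cmod (green \<kappa> x t) \<le> 1 / cmod \<kappa> * exp (- Im \<kappa> * \<bar>x - t\<bar>)"
proof -
  have "cmod (exp (\<i> * \<kappa> * of_real \<bar>x - t\<bar>) - exp (\<i> * \<kappa> * of_real (x + t))) \<le>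
      exp (- Im \<kappa> * \<bar>x - t\<bar>) + exp (- Im \<kappa> * (x + t))"
    using norm_triangle_ineq4 norm_exp_ii by metis
  also have "exp (- Im \<kappa> * (x + t)) \<le> exp (- Im \<kappa> * \<bar>x - t\<bar>)"
    using assms by (auto intro!: mult_left_mono)
  finally have "cmod (exp (\<i> * \<kappa> * of_real \<bar>x - t\<bar>) - exp (\<i> * \<kappa> * of_real (x + t))) \<le>
      2 * exp (- Im \<kappa> * \<bar>x - t\<bar>)" by simp
  then have "1 / (2 * cmod \<kappa>) * cmod (exp (\<i> * \<kappa> * of_real \<bar>x - t\<bar>) - exp (\<i> * \<kappa> * of_real (x + t))) \<le>
      1 / (2 * cmod \<kappa>) * (2 * exp (- Im \<kappa> * \<bar>x - t\<bar>))"
    by (rule mult_left_mono) simp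
  then show ?thesis
    unfolding green_def by (simp only: norm_mult norm_divide) simp
qed

lemma norm_green_dx_le:
  assumes "0 \<le> x" "0 \<le> t" "0 \<le> Im \<kappa>"
  shows "cmod (green_dx \<kappa> x t) \<le> 1 * exp (- Im \<kappa> * \<bar>x - t\<bar>)"
proof -
  have "cmod ((if t \<le> x then 1 else - 1) * exp (\<i> * \<kappa> * of_real \<bar>x - t\<bar>) - exp (\<i> * \<kappa> * of_real (x + t))) \<le>
      exp (- Im \<kappa> * \<bar>x - t\<bar>) + exp (- Im \<kappa> * (x + t))"
    by (rule order_trans[OF norm_triangle_ineq4]) (simp only: norm_mult norm_exp_ii, simp)
  also have "exp (- Im \<kappa> * (x + t)) \<le> exp (- Im \<kappa> * \<bar>x - t\<bar>)"
    using assms by (auto intro!: mult_left_mono)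
  finally show ?thesis unfolding green_dx_def by (simp only: norm_mult) simp
qed

lemma has_vector_derivative_exp_affine:
  "((\<lambda>u. exp (c * of_real (a + b * u)) :: complex) has_vector_derivative
    (c * of_real b * exp (c * of_real (a + b * u)))) (at u within S)"
proof -
  have "((\<lambda>z. exp (c * (of_real a + of_real b * z))) has_field_derivative
    (c * of_real b * exp (c * (of_real a + of_real b * of_real u)))) (at (of_real u))"
    by (auto intro!: derivative_eq_intros)
  from has_vector_derivative_real_field[OF this] show ?thesis by simp
qed

text \<open>The kernel is continuous across the diagonal, so the fundamental theorem applies with
  \<open>t\<close> as the single exceptional point, and \<open>green \<kappa> 0 t = 0\<close>
  removes the lower endpoint.\<close>

lemma green_dx_has_integral:
  assumes \<kappa>: "\<kappa> \<noteq> 0" and x: "0 \<le> x" and t: "0 < t"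
  shows "((\<lambda>u. green_dx \<kappa> u t) has_integral green \<kappa> x t) {0..x}"
proof -
  have "((\<lambda>u. green_dx \<kappa> u t) has_integral (green \<kappa> x t - green \<kappa> 0 t)) {0..x}"
  proof (rule fundamental_theorem_of_calculus_interior_strong[where S = "{t}"])
    fix u assume u: "u \<in> {0<..<x} - {t}"
    let ?e = "\<lambda>a b u. exp (\<i> * \<kappa> * of_real (a + b * u))"
    show "((\<lambda>u. green \<kappa> u t) has_vector_derivative green_dx \<kappa> u t) (at u)"
    proof (cases "u < t")
      case True
      have "((\<lambda>u. \<i> / (2 * \<kappa>) * (?e t (- 1) u - ?e t 1 u)) has_vector_derivative
          \<i> / (2 * \<kappa>) * (\<i> * \<kappa> * of_real (- 1) * ?e t (- 1) u - \<i> * \<kappa> * of_real 1 * ?e t 1 u)) (at u)"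
        by (intro derivative_intros has_vector_derivative_exp_affine)
      also have "\<i> / (2 * \<kappa>) * (\<i> * \<kappa> * of_real (- 1) * ?e t (- 1) u - \<i> * \<kappa> * of_real 1 * ?e t 1 u) =
          green_dx \<kappa> u t"
        using \<kappa> True by (simp add: green_dx_def field_simps)
      finally show ?thesis
        by (rule has_vector_derivative_transform_within_open[where S = "{..<t}"])
          (use True in \<open>auto simp: green_def add_ac\<close>)
    next
      case False
      then have ut: "t < u" using u by auto
      have "((\<lambda>u. \<i> / (2 * \<kappa>) * (?e (- t) 1 u - ?e t 1 u)) has_vector_derivative
          \<i> / (2 * \<kappa>) * (\<i> * \<kappa> * of_real 1 * ?e (- t) 1 u - \<i> * \<kappa> * of_real 1 * ?e t 1 u)) (at u)"
        by (intro derivative_intros has_vector_derivative_exp_affine)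
      also have "\<i> / (2 * \<kappa>) * (\<i> * \<kappa> * of_real 1 * ?e (- t) 1 u - \<i> * \<kappa> * of_real 1 * ?e t 1 u) =
          green_dx \<kappa> u t"
        using \<kappa> ut by (simp add: green_dx_def field_simps)
      finally show ?thesis
        by (rule has_vector_derivative_transform_within_open[where S = "{t<..}"])
          (use ut in \<open>auto simp: green_def add_ac\<close>)
    qed
  next
    show "continuous_on {0..x} (\<lambda>u. green \<kappa> u t)"
      unfolding green_def by (intro continuous_intros)
  qed (use x in auto)
  then show ?thesis using t by simp
qed

text \<open>Adding a unit step repairs the jump of \<open>green_dx\<close> and gives the continuous
  primitive \<open>\<Phi>\<close>. The step is the integrated delta function, the source of the
  inhomogeneity in the differential equation.\<close>

lemma green_has_integral:
  assumes \<kappa>: "\<kappa> \<noteq> 0" and x: "0 \<le> x" and t: "0 < t"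
  shows "((\<lambda>u. - \<kappa>\<^sup>2 * green \<kappa> u t) has_integral
    (green_dx \<kappa> x t - green_dx \<kappa> 0 t + (if t \<le> x then 1 else 0))) {0..x}"
proof -
  define \<Phi> where "\<Phi> u = green_dx \<kappa> u t + (if t \<le> u then 1 else 0)" for u
  let ?e = "\<lambda>a b u. exp (\<i> * \<kappa> * of_real (a + b * u))"
  have \<Phi>1: "\<Phi> u = 1 / 2 * (?e t (- 1) u + ?e t 1 u)" if "u \<le> t" for u
    using that by (cases "u = t") (auto simp: \<Phi>_def green_dx_def add_ac field_simps)
  have \<Phi>2: "\<Phi> u = 1 - 1 / 2 * (?e (- t) 1 u - ?e t 1 u)" if "u \<ge> t" for u
    using that by (auto simp: \<Phi>_def green_dx_def add_ac field_simps)
  have "((\<lambda>u. - \<kappa>\<^sup>2 * green \<kappa> u t) has_integral (\<Phi> x - \<Phi> 0)) {0..x}"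
  proof (rule fundamental_theorem_of_calculus_interior_strong[where S = "{t}"])
    fix u assume u: "u \<in> {0<..<x} - {t}"
    show "(\<Phi> has_vector_derivative - \<kappa>\<^sup>2 * green \<kappa> u t) (at u)"
    proof (cases "u < t")
      case True
      have "((\<lambda>u. 1 / 2 * (?e t (- 1) u + ?e t 1 u)) has_vector_derivative
          1 / 2 * (\<i> * \<kappa> * of_real (- 1) * ?e t (- 1) u + \<i> * \<kappa> * of_real 1 * ?e t 1 u)) (at u)"
        by (intro derivative_intros has_vector_derivative_exp_affine)
      also have "1 / 2 * (\<i> * \<kappa> * of_real (- 1) * ?e t (- 1) u + \<i> * \<kappa> * of_real 1 * ?e t 1 u) =
          - \<kappa>\<^sup>2 * green \<kappa> u t"
        using \<kappa> True by (simp add: green_def field_simps power2_eq_square)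
      finally show ?thesis
        by (rule has_vector_derivative_transform_within_open[where S = "{..<t}"])
          (use True in \<open>auto simp: \<Phi>1\<close>)
    next
      case False
      then have ut: "t < u" using u by auto
      have "((\<lambda>u. 1 - 1 / 2 * (?e (- t) 1 u - ?e t 1 u)) has_vector_derivative
          0 - 1 / 2 * (\<i> * \<kappa> * of_real 1 * ?e (- t) 1 u - \<i> * \<kappa> * of_real 1 * ?e t 1 u)) (at u)"
        by (intro derivative_intros has_vector_derivative_exp_affine)
      also have "0 - 1 / 2 * (\<i> * \<kappa> * of_real 1 * ?e (- t) 1 u - \<i> * \<kappa> * of_real 1 * ?e t 1 u) =
          - \<kappa>\<^sup>2 * green \<kappa> u t"
        using \<kappa> ut by (simp add: green_def field_simps power2_eq_square)
      finally show ?thesis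
        by (rule has_vector_derivative_transform_within_open[where S = "{t<..}"])
          (use ut in \<open>auto simp: \<Phi>2\<close>)
    qed
  next
    have "continuous_on {0..x} (\<lambda>u. if u \<le> t then 1 / 2 * (?e t (- 1) u + ?e t 1 u)
        else 1 - 1 / 2 * (?e (- t) 1 u - ?e t 1 u))"
      by (rule continuous_on_cases_le) (intro continuous_intros | force simp: field_simps)+
    then show "continuous_on {0..x} \<Phi>"
      by (rule continuous_on_eq) (auto simp: \<Phi>1 \<Phi>2)
  qed (use x in auto)
  then show ?thesis using t by (simp add: \<Phi>_def algebra_simps)
qed

section \<open>Integral operators with exponentially decaying kernels\<close>

lemma exp_abs_half_line:
  assumes \<eta>: "0 < \<eta>" and t: "0 < t"
  shows "integrable half_line (\<lambda>x. exp (- \<eta> * \<bar>x - t\<bar>))"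
    and "(LINT x|half_line. exp (- \<eta> * \<bar>x - t\<bar>)) \<le> 2 / \<eta>"
proof -
  have "((\<lambda>x. exp (- \<eta> * (t - x))) has_integral (exp (- \<eta> * (t - t)) / \<eta> - exp (- \<eta> * (t - 0)) / \<eta>)) {0..t}"
    using \<eta> t by (intro fundamental_theorem_of_calculus)
      (auto intro!: derivative_eq_intros simp: has_real_derivative_iff_has_vector_derivative[symmetric])
  then have 1: "((\<lambda>x. exp (- \<eta> * \<bar>x - t\<bar>)) has_integral (1 / \<eta> - exp (- \<eta> * t) / \<eta>)) {0..t}"
    by (rule has_integral_eq_rhs[OF has_integral_eq[rotated]]) auto
  have "((\<lambda>x. exp (\<eta> * t) * exp (- \<eta> * x)) has_integral (exp (\<eta> * t) * (exp (- \<eta> * t) / \<eta>))) {t..}"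
    by (intro has_integral_mult_right has_integral_exp_minus_to_infinity \<eta>)
  then have 2: "((\<lambda>x. exp (- \<eta> * \<bar>x - t\<bar>)) has_integral 1 / \<eta>) {t..}"
    by (rule has_integral_eq_rhs[OF has_integral_eq[rotated]])
      (auto simp: mult_exp_exp algebra_simps)
  have "((\<lambda>x. exp (- \<eta> * \<bar>x - t\<bar>)) has_integral (1 / \<eta> - exp (- \<eta> * t) / \<eta> + 1 / \<eta>)) ({0..t} \<union> {t..})"
    by (rule has_integral_Un[OF 1 2]) (rule negligible_subset[of "{t}"], auto)
  also have "{0..t} \<union> {t..} = {0..}"
    using t by auto
  finally have "((\<lambda>x. exp (- \<eta> * \<bar>x - t\<bar>)) has_integral (1 / \<eta> - exp (- \<eta> * t) / \<eta> + 1 / \<eta>)) {0<..}"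
    by (rule has_integral_spike_set_eq[THEN iffD1, rotated 2]) (rule negligible_subset[of "{0}"], auto)+
  moreover from this have "(\<lambda>x. exp (- \<eta> * \<bar>x - t\<bar>)) absolutely_integrable_on {0<..}"
    by (intro nonnegative_absolutely_integrable_1) auto
  then show "integrable half_line (\<lambda>x. exp (- \<eta> * \<bar>x - t\<bar>))"
    by (simp add: set_integrable_def integrable_restrict_space)
  ultimately have "(LINT x|half_line. exp (- \<eta> * \<bar>x - t\<bar>)) = 1 / \<eta> - exp (- \<eta> * t) / \<eta> + 1 / \<eta>"
    by (subst lebesgue_integral_eq_integral) (auto simp: has_integral_iff)
  also have "\<dots> \<le> 2 / \<eta>"
    using \<eta> by (simp add: divide_simps)
  finally show "(LINT x|half_line. exp (- \<eta> * \<bar>x - t\<bar>)) \<le> 2 / \<eta>" .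
qed

text \<open>Integrating in \<open>x\<close> first costs at most \<open>C * (2 / \<eta>)\<close>
  uniformly in \<open>t\<close>, so Fubini yields an integrable function. It is also bounded, as
  \<open>K\<close> is bounded and \<open>v\<close> integrable; a bounded integrable function is
  square integrable.\<close>

lemma L12_fun_kernel:
  fixes K :: "real \<Rightarrow> real \<Rightarrow> complex"
  assumes K [measurable]: "(\<lambda>(x, t). K x t) \<in> borel_measurable (half_line \<Otimes>\<^sub>M half_line)"
    and \<eta>: "0 < \<eta>" and C: "0 \<le> C"
    and le: "\<And>x t. 0 < x \<Longrightarrow> 0 < t \<Longrightarrow> cmod (K x t) \<le> C * exp (- \<eta> * \<bar>x - t\<bar>)"
    and v: "integrable half_line v"
  shows "L12_fun (\<lambda>x. LINT t|half_line. K x t * v t)"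
proof -
  interpret P: pair_sigma_finite half_line half_line
    by (rule pair_sigma_finite_lebesgue_on) auto
  have v_meas [measurable]: "v \<in> borel_measurable half_line" using v by auto
  have K' [measurable]: "(\<lambda>(t, x). K x t) \<in> borel_measurable (half_line \<Otimes>\<^sub>M half_line)"
    using measurable_compose[OF measurable_pair_swap' K] by (simp add: case_prod_unfold)
  have Kx [measurable]: "(\<lambda>x. K x t) \<in> borel_measurable half_line" if "t > 0" for t
    using measurable_Pair2[OF K', of t] that by (simp add: space_restrict_space)
  have le': "cmod (K x t) \<le> C" if "0 < x" "0 < t" for x t
  proof -
    have "C * exp (- \<eta> * \<bar>x - t\<bar>) \<le> C * 1"
      using C \<eta> by (intro mult_left_mono) auto
    then show ?thesis using le[OF that] by simp
  qed
  have int_x: "integrable half_line (\<lambda>x. K x t * v t)" if t: "t > 0" for t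
  proof (rule Bochner_Integration.integrable_bound)
    show "integrable half_line (\<lambda>x. C * exp (- \<eta> * \<bar>x - t\<bar>) * cmod (v t))"
      by (intro integrable_mult_left integrable_mult_right exp_abs_half_line \<eta> t)
    show "AE x in half_line. norm (K x t * v t) \<le> norm (C * exp (- \<eta> * \<bar>x - t\<bar>) * cmod (v t))"
      using le t C by (auto intro!: AE_I2 mult_right_mono simp: norm_mult abs_mult)
  qed (use Kx[OF t] in measurable)
  have int: "integrable (half_line \<Otimes>\<^sub>M half_line) (\<lambda>(t, x). K x t * v t)"
  proof (rule P.Fubini_integrable)
    show "AE t in half_line. integrable half_line (\<lambda>x. case (t, x) of (t, x) \<Rightarrow> K x t * v t)"
      using int_x by (auto intro!: AE_I2)
    show "integrable half_line (\<lambda>t. LINT x|half_line. norm (case (t, x) of (t, x) \<Rightarrow> K x t * v t))"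
    proof (rule Bochner_Integration.integrable_bound)
      show "integrable half_line (\<lambda>t. C * (2 / \<eta>) * cmod (v t))"
        using v by (intro integrable_mult_right) auto
      have "(LINT x|half_line. norm (K x t * v t)) \<le> C * (2 / \<eta>) * cmod (v t)" if t: "t > 0" for t
      proof -
        have "(LINT x|half_line. norm (K x t * v t)) \<le> (LINT x|half_line. C * exp (- \<eta> * \<bar>x - t\<bar>) * cmod (v t))"
          using le t C by (intro integral_mono' integrable_mult_left integrable_mult_right exp_abs_half_line \<eta> t)
            (auto intro!: mult_right_mono simp: norm_mult)
        also have "\<dots> = C * (LINT x|half_line. exp (- \<eta> * \<bar>x - t\<bar>)) * cmod (v t)"
          by simp
        also have "\<dots> \<le> C * (2 / \<eta>) * cmod (v t)"
          using C by (intro mult_right_mono mult_left_mono exp_abs_half_line \<eta> t) auto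
        finally show ?thesis .
      qed
      then show "AE t in half_line. norm (LINT x|half_line. norm (case (t, x) of (t, x) \<Rightarrow> K x t * v t))
          \<le> norm (C * (2 / \<eta>) * cmod (v t))"
        using C \<eta> by (auto intro!: AE_I2 simp: abs_mult)
    qed measurable
  qed measurable
  define h where "h x = (LINT t|half_line. K x t * v t)" for x
  have h: "integrable half_line h"
    unfolding h_def using P.integrable_snd[OF int] by simp
  define B where "B = C * (LINT t|half_line. cmod (v t))"
  have h_le: "cmod (h x) \<le> B" if x: "x > 0" for x
  proof -
    have "cmod (h x) \<le> (LINT t|half_line. norm (K x t * v t))"
      unfolding h_def by (rule integral_norm_bound)
    also have "\<dots> \<le> (LINT t|half_line. C * cmod (v t))"
      using v x C le' by (intro integral_mono') (auto intro!: mult_right_mono simp: norm_mult)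
    finally show ?thesis by (simp add: B_def)
  qed
  have "integrable half_line (\<lambda>x. (cmod (h x))\<^sup>2)"
  proof (rule Bochner_Integration.integrable_bound)
    show "integrable half_line (\<lambda>x. B * cmod (h x))"
      using h by auto
    show "AE x in half_line. norm ((cmod (h x))\<^sup>2) \<le> norm (B * cmod (h x))"
    proof (rule AE_I2)
      fix x assume "x \<in> space half_line"
      then have "cmod (h x) \<le> B" by (intro h_le) simp
      then have "cmod (h x) * cmod (h x) \<le> B * cmod (h x)"
        by (intro mult_right_mono) auto
      then show "norm ((cmod (h x))\<^sup>2) \<le> norm (B * cmod (h x))"
        by (simp add: power2_eq_square)
    qed
  qed (use h in measurable)
  with h show ?thesis by (simp add: L12_fun_def h_def[abs_def])
qed

text \<open>Fubini on a bounded interval times the half-line. It turns a primitive of the kernel in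
  its first variable into an indefinite integral of the operator, the form of absolute continuity
  required by \<open>W22_derivs\<close>.\<close>

lemma kernel_Fubini_Ioc:
  fixes K :: "real \<Rightarrow> real \<Rightarrow> complex"
  assumes K [measurable]: "(\<lambda>(u, t). K u t) \<in> borel_measurable (lebesgue_on {0<..x} \<Otimes>\<^sub>M half_line)"
    and C: "0 \<le> C" and le: "\<And>u t. 0 < u \<Longrightarrow> 0 < t \<Longrightarrow> cmod (K u t) \<le> C"
    and v: "integrable half_line v"
    and I: "\<And>t. 0 < t \<Longrightarrow> ((\<lambda>u. K u t) has_integral I t) {0..x}"
  shows "(LINT u|lebesgue_on {0<..x}. LINT t|half_line. K u t * v t) = (LINT t|half_line. I t * v t)"
proof -
  interpret P: pair_sigma_finite "lebesgue_on {0<..x}" half_line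
    by (rule pair_sigma_finite_lebesgue_on) auto
  have v_meas [measurable]: "v \<in> borel_measurable half_line" using v by auto
  have one: "integrable (lebesgue_on {0<..x}) (\<lambda>_. c)" for c :: complex
    by (intro finite_measure.integrable_const finite_measure_lebesgue_on bounded_set_imp_lmeasurable) auto
  have int: "integrable (lebesgue_on {0<..x} \<Otimes>\<^sub>M half_line) (\<lambda>(u, t). K u t * v t)"
  proof (rule Bochner_Integration.integrable_bound)
    show "integrable (lebesgue_on {0<..x} \<Otimes>\<^sub>M half_line) (\<lambda>(u, t). of_real C * v t)"
      by (rule integrable_prod_mult[OF pair_sigma_finite_lebesgue_on one v]) auto
    show "AE p in lebesgue_on {0<..x} \<Otimes>\<^sub>M half_line.
        norm (case p of (u, t) \<Rightarrow> K u t * v t) \<le> norm (case p of (u, t) \<Rightarrow> of_real C * v t)"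
      using le C by (intro AE_I2) (auto simp: space_pair_measure norm_mult intro!: mult_right_mono)
  qed measurable
  have "(LINT u|lebesgue_on {0<..x}. LINT t|half_line. K u t * v t) =
      (LINT t|half_line. LINT u|lebesgue_on {0<..x}. K u t * v t)"
    using P.Fubini_integral[OF int] by simp
  also have "\<dots> = (LINT t|half_line. I t * v t)"
  proof (rule Bochner_Integration.integral_cong[OF refl])
    fix t assume "t \<in> space half_line"
    then have t: "t > 0" by simp
    have Ku: "(\<lambda>u. K u t) \<in> borel_measurable (lebesgue_on {0<..x})"
      using measurable_Pair1[OF K, of t] t by simp
    have "integrable (lebesgue_on {0<..x}) (\<lambda>u. K u t)"
      by (rule Bochner_Integration.integrable_bound[OF one[of "of_real C"] Ku])
        (use le t C in \<open>auto intro!: AE_I2\<close>)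
    then have "(LINT u|lebesgue_on {0<..x}. K u t) = I t"
      using I[OF t] by (simp add: lebesgue_on_Ioc_integral has_integral_iff)
    then show "(LINT u|lebesgue_on {0<..x}. K u t * v t) = I t * v t"
      by simp
  qed
  finally show ?thesis .
qed

text \<open>The Green operator solves -y'' - \<kappa>^2 y = v with y(0) = 0. Both absolute
  continuity identities are the kernel integrals \<open>green_dx_has_integral\<close> and
  \<open>green_has_integral\<close> carried through Fubini.\<close>

lemma W22_green_op:
  assumes \<kappa>: "0 < Im \<kappa>" and v: "L12_fun v"
  shows "W22_derivs (green_op \<kappa> v) (green_op_dx \<kappa> v) (\<lambda>x. - \<kappa>\<^sup>2 * green_op \<kappa> v x - v x)"
    and "L12_fun (green_op \<kappa> v)" and "green_op \<kappa> v 0 = 0"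
proof -
  have \<kappa>0: "\<kappa> \<noteq> 0" using \<kappa> by auto
  have vint: "integrable half_line v" using v by (simp add: L12_fun_def)
  have L: "L12_fun (green_op \<kappa> v)"
    unfolding green_op_def
    by (rule L12_fun_kernel[OF _ \<kappa> _ norm_green_le vint]) (use \<kappa> in \<open>auto simp: case_prod_unfold\<close>)
  have Ldx: "L12_fun (green_op_dx \<kappa> v)"
    unfolding green_op_dx_def
    by (rule L12_fun_kernel[OF _ \<kappa> _ norm_green_dx_le vint]) (use \<kappa> in \<open>auto simp: case_prod_unfold\<close>)
  have zero: "green_op \<kappa> v 0 = 0"
    unfolding green_op_def by (rule integral_eq_zero_AE) (auto intro!: AE_I2)
  have bound: "cmod (green \<kappa> x t) \<le> 1 / cmod \<kappa>" if "0 \<le> x" "0 < t" for x t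
  proof -
    have "1 / cmod \<kappa> * exp (- Im \<kappa> * \<bar>x - t\<bar>) \<le> 1 / cmod \<kappa> * 1"
      using \<kappa> by (intro mult_left_mono) auto
    then show ?thesis using norm_green_le[of x t \<kappa>] that \<kappa> by simp
  qed
  have bound_dx: "cmod (green_dx \<kappa> x t) \<le> 1" if "0 \<le> x" "0 < t" for x t
  proof -
    have "1 * exp (- Im \<kappa> * \<bar>x - t\<bar>) \<le> 1"
      using \<kappa> by (simp add: mult_nonneg_nonneg less_imp_le)
    then show ?thesis using order_trans[OF norm_green_dx_le[of x t \<kappa>]] that \<kappa> by simp
  qed
  have int_dx: "integrable half_line (\<lambda>t. green_dx \<kappa> x t * v t)" if "x \<ge> 0" for x
    by (rule Bochner_Integration.integrable_bound[OF vint])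
      (use v bound_dx that in \<open>auto intro!: AE_I2 mult_left_le_one_le borel_measurable_times borel_measurable_green_dx
          simp: norm_mult L12_fun_def\<close>)
  have AC1: "green_op \<kappa> v x = green_op \<kappa> v 0 + (LINT t|lebesgue_on {0<..x}. green_op_dx \<kappa> v t)" if x: "x \<ge> 0" for x
  proof -
    have "(LINT u|lebesgue_on {0<..x}. LINT t|half_line. green_dx \<kappa> u t * v t) = (LINT t|half_line. green \<kappa> x t * v t)"
      by (rule kernel_Fubini_Ioc[where C = 1])
        (use vint bound_dx x \<kappa>0 in \<open>auto simp: case_prod_unfold intro: green_dx_has_integral\<close>)
    then show ?thesis
      unfolding zero by (simp add: green_op_def green_op_dx_def)
  qed
  have AC2: "green_op_dx \<kappa> v x = green_op_dx \<kappa> v 0 +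
      (LINT t|lebesgue_on {0<..x}. - \<kappa>\<^sup>2 * green_op \<kappa> v t - v t)" if x: "x \<ge> 0" for x
  proof -
    have vx: "integrable (lebesgue_on {0<..x}) v" "integrable (lebesgue_on {0<..x}) (green_op \<kappa> v)"
      by (intro L2_fun_integrable_Ioc L12_fun_L2 v L)+
    have "(LINT u|lebesgue_on {0<..x}. LINT t|half_line. (- \<kappa>\<^sup>2 * green \<kappa> u t) * v t) =
        (LINT t|half_line. (green_dx \<kappa> x t - green_dx \<kappa> 0 t + (if t \<le> x then 1 else 0)) * v t)"
    proof (rule kernel_Fubini_Ioc[where C = "cmod (\<kappa>\<^sup>2) * (1 / cmod \<kappa>)"])
      show "(\<lambda>(u, t). - \<kappa>\<^sup>2 * green \<kappa> u t) \<in> borel_measurable (lebesgue_on {0<..x} \<Otimes>\<^sub>M half_line)"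
        by (simp add: case_prod_unfold)
      show "cmod (- \<kappa>\<^sup>2 * green \<kappa> u t) \<le> cmod (\<kappa>\<^sup>2) * (1 / cmod \<kappa>)" if "0 < u" "0 < t" for u t
        unfolding norm_mult norm_minus_cancel using bound[of u t] that by (intro mult_left_mono) auto
      show "((\<lambda>u. - \<kappa>\<^sup>2 * green \<kappa> u t) has_integral
          green_dx \<kappa> x t - green_dx \<kappa> 0 t + (if t \<le> x then 1 else 0)) {0..x}" if "0 < t" for t
        by (rule green_has_integral[OF \<kappa>0 x that])
    qed (use vint in auto)
    \<comment> \<open>The last summand stems from the jump on the diagonal; it becomes the integral
      of \<open>v\<close> over \<open>{0<..x}\<close>.\<close>
    also have "\<dots> = (LINT t|half_line. green_dx \<kappa> x t * v t - green_dx \<kappa> 0 t * v t + (if t \<in> {..x} then v t else 0))"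
      by (intro Bochner_Integration.integral_cong) (auto simp: algebra_simps)
    also have "\<dots> = green_op_dx \<kappa> v x - green_op_dx \<kappa> v 0 + (LINT t|half_line. (if t \<in> {..x} then v t else 0))"
    proof -
      have "integrable half_line (\<lambda>t. if t \<in> {..x} then v t else 0)"
        by (rule Bochner_Integration.integrable_bound[OF vint])
         (use vint in \<open>auto intro!: measurable_If\<close>)
      then show ?thesis
        using int_dx[OF x] int_dx[of 0] unfolding green_op_dx_def by simp
    qed
    also have "(LINT t|half_line. (if t \<in> {..x} then v t else 0)) = (LINT t|lebesgue_on {0<..x}. v t)"
      by (subst Lebesgue_Measure.integral_restrict_Int) (auto simp: Int_commute greaterThanAtMost_def)
    also have "(LINT u|lebesgue_on {0<..x}. LINT t|half_line. (- \<kappa>\<^sup>2 * green \<kappa> u t) * v t) =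
        (LINT u|lebesgue_on {0<..x}. - \<kappa>\<^sup>2 * green_op \<kappa> v u)"
      unfolding green_op_def by (simp add: mult.assoc)
    finally show ?thesis
      using vx by simp
  qed
  have L2: "L2_fun (\<lambda>x. - \<kappa>\<^sup>2 * green_op \<kappa> v x - v x)"
    by (intro L2_fun_diff L2_fun_cmult L12_fun_L2 L v)
  show "W22_derivs (green_op \<kappa> v) (green_op_dx \<kappa> v) (\<lambda>x. - \<kappa>\<^sup>2 * green_op \<kappa> v x - v x)"
    unfolding W22_derivs_def using AC1 AC2 L Ldx L2 by (blast intro: L12_fun_L2)
  show "L12_fun (green_op \<kappa> v)" by (fact L)
  show "green_op \<kappa> v 0 = 0" by (fact zero)
qed

subsection \<open>Uniqueness of derivatives and of solutions\<close>

lemma W22_diff: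
  assumes y: "W22_derivs y y1 y2" and z: "W22_derivs z z1 z2"
  shows "W22_derivs (\<lambda>x. y x - z x) (\<lambda>x. y1 x - z1 x) (\<lambda>x. y2 x - z2 x)"
proof -
  have AC: "f x - g x = f 0 - g 0 + (LINT t|lebesgue_on {0<..x}. f1 t - g1 t)"
    if "f x = f 0 + (LINT t|lebesgue_on {0<..x}. f1 t)" "g x = g 0 + (LINT t|lebesgue_on {0<..x}. g1 t)"
      "L2_fun f1" "L2_fun g1" for f g f1 g1 x
    unfolding that(1,2) using that(3,4) by (simp add: L2_fun_integrable_Ioc)
  have L2: "L2_fun y" "L2_fun y1" "L2_fun y2" "L2_fun z" "L2_fun z1" "L2_fun z2"
    using y z by (simp_all add: W22_derivs_def)
  have AC1: "y x - z x = y 0 - z 0 + (LINT t|lebesgue_on {0<..x}. y1 t - z1 t)" if "x \<ge> 0" for x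
    by (rule AC[OF _ _ L2(2,5)]) (use that y z in \<open>unfold W22_derivs_def, blast+\<close>)
  have AC2: "y1 x - z1 x = y1 0 - z1 0 + (LINT t|lebesgue_on {0<..x}. y2 t - z2 t)" if "x \<ge> 0" for x
    by (rule AC[OF _ _ L2(3,6)]) (use that y z in \<open>unfold W22_derivs_def, blast+\<close>)
  show ?thesis
    unfolding W22_derivs_def using AC1 AC2 L2 by (blast intro: L2_fun_diff)
qed

lemma indefinite_integral_continuous_on:
  assumes g: "L2_fun g" and f: "\<And>x. x \<ge> 0 \<Longrightarrow> f x = f 0 + (LINT t|lebesgue_on {0<..x}. g t)"
  shows "continuous_on {0..} f"
proof (rule continuous_on_eq)
  note g' = lebesgue_on_Ioc_integral[OF L2_fun_integrable_Ioc[OF g]]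
  show "continuous_on {0..} (\<lambda>x. f 0 + integral {0..x} g)"
    unfolding continuous_on_eq_continuous_within
  proof
    fix x :: real assume "x \<in> {0..}"
    have "continuous_on {0..x + 1} (\<lambda>x. f 0 + integral {0..x} g)"
      by (intro continuous_intros indefinite_integral_continuous_1 g')
    moreover have "at x within {0..} = at x within {0..x + 1}"
      by (rule at_within_nhd[of _ "{..<x + 1}"]) auto
    ultimately show "continuous (at x within {0..}) (\<lambda>x. f 0 + integral {0..x} g)"
      using \<open>x \<in> {0..}\<close> by (simp add: continuous_on_eq_continuous_within continuous_within)
  qed
  show "f 0 + integral {0..x} g = f x" if "x \<in> {0..}" for x
    using f[of x] g'(2)[of x] that by simp
qed

lemma indefinite_integral_derivative:
  assumes g: "L2_fun g" and f: "\<And>x. x \<ge> 0 \<Longrightarrow> f x = f 0 + (LINT t|lebesgue_on {0<..x}. g t)"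
    and cont: "continuous_on {0..} g" and x: "x \<ge> 0"
  shows "(f has_vector_derivative g x) (at x within {0..})"
proof -
  note g' = lebesgue_on_Ioc_integral[OF L2_fun_integrable_Ioc[OF g]]
  have "((\<lambda>u. f 0 + integral {0..u} g) has_vector_derivative 0 + g x) (at x within {0..x + 1})"
    by (intro derivative_intros integral_has_vector_derivative continuous_on_subset[OF cont])
      (use x in auto)
  moreover have "at x within {0..} = at x within {0..x + 1}"
    by (rule at_within_nhd[of _ "{..<x + 1}"]) auto
  ultimately have deriv: "((\<lambda>u. f 0 + integral {0..u} g) has_vector_derivative g x) (at x within {0..})"
    by simp
  have eq: "f u = f 0 + integral {0..u} g" if "u \<in> {0..}" for u
    using f[of u] g'(2)[of u] that by simp
  show ?thesis
    by (rule has_vector_derivative_transform[OF _ eq deriv]) (use x in auto)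
qed

text \<open>\<open>second_deriv\<close> is an arbitrary choice, so it is compared with
  \<open>y2\<close>. The differences form a pair of derivatives of the zero function:
  \<open>d1\<close> is continuous, hence a classical derivative, and vanishes; then
  \<open>d2\<close> has zero integrals over all \<open>{0<..x}\<close>.\<close>

lemma second_deriv_AE:
  assumes y: "W22_derivs y y1 y2"
  shows "AE x in half_line. second_deriv y x = y2 x"
proof -
  obtain z1 where z: "W22_derivs y z1 (second_deriv y)"
    using someI_ex[of "\<lambda>y2. \<exists>y1. W22_derivs y y1 y2"] y unfolding second_deriv_def by blast
  define d1 where "d1 x = z1 x - y1 x" for x
  define d2 where "d2 x = second_deriv y x - y2 x" for x
  have d: "W22_derivs (\<lambda>x. 0) d1 d2"
    using W22_diff[OF z y] by (simp add: d1_def[abs_def] d2_def[abs_def])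
  have L2: "L2_fun d1" "L2_fun d2"
    and AC1: "\<And>x. x \<ge> 0 \<Longrightarrow> 0 = 0 + (LINT t|lebesgue_on {0<..x}. d1 t)"
    and AC2: "\<And>x. x \<ge> 0 \<Longrightarrow> d1 x = d1 0 + (LINT t|lebesgue_on {0<..x}. d2 t)"
    using d unfolding W22_derivs_def by blast+
  have d1: "d1 x = 0" if x: "x \<ge> 0" for x
  proof -
    have "((\<lambda>x. 0) has_vector_derivative d1 x) (at x within {0..})"
      by (rule indefinite_integral_derivative[OF L2(1) AC1 _ x])
        (auto intro: indefinite_integral_continuous_on[OF L2(2) AC2])
    then have "((\<lambda>x. 0) has_vector_derivative d1 x) (at x within cbox 0 (x + 1))"
      by (rule has_vector_derivative_within_subset) auto
    then show ?thesis
      using x by (intro vector_derivative_unique_within_closed_interval[of 0 "x + 1" x "\<lambda>_. 0"]) auto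
  qed
  have "AE x in half_line. d2 x = 0"
    by (rule AE_zero_of_Ioc_integrals[OF L2(2)]) (use AC2 d1 in simp)
  then show ?thesis
    by (simp add: d2_def)
qed

text \<open>For s = i \<kappa> and s = -i \<kappa> the function (h' - s h) exp(s x) is constant.
  With the decaying exponential a nonzero constant would keep h' - s h away from 0, against square
  integrability. So h' = i \<kappa> h, and the other sign gives h' = -i \<kappa> h because h'(0) =
  0.\<close>

lemma helmholtz_unique:
  assumes \<kappa>: "0 < Im \<kappa>" and h: "W22_derivs h h1 h2" and h0: "h 0 = 0"
    and AE: "AE x in half_line. h2 x = - \<kappa>\<^sup>2 * h x" and x: "x \<ge> 0"
  shows "h x = 0"
proof -
  have L2: "L2_fun h" "L2_fun h1" "L2_fun h2"
    and AC1: "\<And>x. x \<ge> 0 \<Longrightarrow> h x = h 0 + (LINT t|lebesgue_on {0<..x}. h1 t)"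
    and AC2: "\<And>x. x \<ge> 0 \<Longrightarrow> h1 x = h1 0 + (LINT t|lebesgue_on {0<..x}. h2 t)"
    using h unfolding W22_derivs_def by blast+
  \<comment> \<open>Replacing \<open>h2\<close> by the continuous function it equals almost
    everywhere makes \<open>h1\<close> classically differentiable.\<close>
  have AC2': "h1 x = h1 0 + (LINT t|lebesgue_on {0<..x}. - \<kappa>\<^sup>2 * h t)" if x: "x \<ge> 0" for x
  proof -
    have "AE t in lebesgue. t > 0 \<longrightarrow> h2 t = - \<kappa>\<^sup>2 * h t"
      using AE by (simp add: AE_restrict_space_iff)
    then have "AE t in lebesgue_on {0<..x}. h2 t = - \<kappa>\<^sup>2 * h t"
      by (simp add: AE_restrict_space_iff) (auto elim: eventually_mono)
    moreover have "integrable (lebesgue_on {0<..x}) h2" "integrable (lebesgue_on {0<..x}) h"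
      using L2 by (auto intro: L2_fun_integrable_Ioc)
    ultimately have "(LINT t|lebesgue_on {0<..x}. h2 t) = (LINT t|lebesgue_on {0<..x}. - \<kappa>\<^sup>2 * h t)"
      by (intro integral_cong_AE) auto
    then show ?thesis using AC2[OF x] by simp
  qed
  have cont: "continuous_on {0..} h" "continuous_on {0..} h1"
    by (rule indefinite_integral_continuous_on[OF L2(2) AC1], simp,
        rule indefinite_integral_continuous_on[OF L2(3) AC2], simp)
  have D1: "(h has_vector_derivative h1 x) (at x within {0..})" if "x \<ge> 0" for x
    using indefinite_integral_derivative[OF L2(2) AC1 cont(2) that] by simp
  have D2: "(h1 has_vector_derivative - \<kappa>\<^sup>2 * h x) (at x within {0..})" if "x \<ge> 0" for x
    by (rule indefinite_integral_derivative[OF L2_fun_cmult[OF L2(1)] AC2' _ that])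
      (auto intro!: continuous_intros cont)
  have const: "(h1 x - s * h x) * exp (s * of_real x) = h1 0 - s * h 0"
    if s: "s\<^sup>2 = - \<kappa>\<^sup>2" and x: "x \<ge> 0" for s x
  proof -
    have Z: "((\<lambda>x. (h1 x - s * h x) * exp (s * of_real (0 + 1 * x))) has_vector_derivative 0) (at x within {0..})"
      if "x \<in> {0..}" for x
    proof -
      have "((\<lambda>x. (h1 x - s * h x) * exp (s * of_real (0 + 1 * x))) has_vector_derivative
          ((h1 x - s * h x) * (s * of_real 1 * exp (s * of_real (0 + 1 * x))) +
           (- \<kappa>\<^sup>2 * h x - s * h1 x) * exp (s * of_real (0 + 1 * x)))) (at x within {0..})"
        using that by (intro derivative_intros has_vector_derivative_exp_affine D1 D2) auto
      also have "(h1 x - s * h x) * (s * of_real 1 * exp (s * of_real (0 + 1 * x))) +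
           (- \<kappa>\<^sup>2 * h x - s * h1 x) * exp (s * of_real (0 + 1 * x)) = 0"
        unfolding s[symmetric] by (simp add: algebra_simps power2_eq_square)
      finally show ?thesis .
    qed
    show ?thesis
    proof (rule has_vector_derivative_zero_constant[OF convex_real_interval(1) Z])
      fix c assume "\<And>x. x \<in> {0..} \<Longrightarrow> (h1 x - s * h x) * exp (s * of_real (0 + 1 * x)) = c"
      from this[of x] this[of 0] x show ?thesis by simp
    qed
  qed
  define p where "p x = h1 x - \<i> * \<kappa> * h x" for x
  have p0: "p 0 = 0"
  proof (rule ccontr)
    assume p0: "p 0 \<noteq> 0"
    have le: "cmod (p 0) \<le> cmod (p x)" if x: "x \<ge> 0" for x
    proof -
      have "p x * exp (\<i> * \<kappa> * of_real x) = p 0"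
        using const[of "\<i> * \<kappa>" x] x by (simp add: p_def power_mult_distrib)
      then have "cmod (p 0) = cmod (p x) * exp (- Im \<kappa> * x)"
        by (metis norm_mult norm_exp_ii)
      also have "\<dots> \<le> cmod (p x) * 1"
        using \<kappa> x by (intro mult_left_mono) auto
      finally show ?thesis by simp
    qed
    have "L2_fun p"
      unfolding p_def[abs_def] by (intro L2_fun_diff L2_fun_cmult L2)
    then have int: "integrable half_line (\<lambda>x. (cmod (p x))\<^sup>2)"
      by (simp add: L2_fun_def)
    define I where "I = (LINT x|half_line. (cmod (p x))\<^sup>2)"
    have "b * (cmod (p 0))\<^sup>2 \<le> I" if b: "b > 0" for b :: real
    proof -
      have "b * (cmod (p 0))\<^sup>2 = (LINT x|lebesgue_on {0<..b}. (cmod (p 0))\<^sup>2)"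
        using b by (simp add: measure_restrict_space)
      also have "\<dots> \<le> I"
        unfolding I_def
      proof (rule integral_mono_lebesgue_on_AE[OF int])
        show "AE x in lebesgue_on {0<..b}. (cmod (p 0))\<^sup>2 \<le> (cmod (p x))\<^sup>2"
          using le by (intro AE_I2) (auto intro!: power_mono)
      qed auto
      finally show ?thesis .
    qed
    \<comment> \<open>The interval is long enough for its contribution to exceed the total integral
      \<open>I\<close>.\<close>
    from this[of "(\<bar>I\<bar> + 1) / (cmod (p 0))\<^sup>2"] have "\<bar>I\<bar> + 1 \<le> I"
      using p0 by (simp add: zero_less_divide_iff)
    then show False by simp
  qed
  have "h1 x - \<i> * \<kappa> * h x = 0"
    using const[of "\<i> * \<kappa>" x] x p0 by (simp add: p_def power_mult_distrib)
  moreover have "h1 0 = 0" using p0 h0 by (simp add: p_def)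
  then have "h1 x + \<i> * \<kappa> * h x = 0"
    using const[of "- (\<i> * \<kappa>)" x] x h0 by (simp add: power_mult_distrib)
  ultimately have "2 * (\<i> * \<kappa>) * h x = 0" by (simp add: algebra_simps)
  then show ?thesis using \<kappa> by auto
qed

subsection \<open>Resolvents of the perturbed operators\<close>

lemma borel_measurable_green_op:
  assumes f: "integrable half_line f"
  shows "green_op \<kappa> f \<in> borel_measurable half_line"
proof -
  interpret sigma_finite_measure half_line
    by (rule sigma_finite_lebesgue_on) simp
  have [measurable]: "f \<in> borel_measurable half_line" using f by auto
  show ?thesis
    unfolding green_op_def[abs_def]
    by (rule borel_measurable_lebesgue_integral) (simp add: case_prod_unfold)
qed

lemma norm_green_le_inverse:
  assumes "0 \<le> x" "0 \<le> t" "0 \<le> Im \<kappa>"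
  shows "cmod (green \<kappa> x t) \<le> 1 / cmod \<kappa>"
proof -
  have "exp (- Im \<kappa> * \<bar>x - t\<bar>) \<le> 1"
    using assms by simp
  then have "1 / cmod \<kappa> * exp (- Im \<kappa> * \<bar>x - t\<bar>) \<le> 1 / cmod \<kappa> * 1"
    by (rule mult_left_mono) simp
  then show ?thesis using order_trans[OF norm_green_le[OF assms]] by simp
qed

lemma integrable_green_mult:
  assumes f: "integrable half_line f" and \<kappa>: "0 \<le> Im \<kappa>" and x: "0 \<le> x"
  shows "integrable half_line (\<lambda>t. green \<kappa> x t * f t)"
proof (rule Bochner_Integration.integrable_bound)
  have [measurable]: "f \<in> borel_measurable half_line" using f by auto
  show "integrable half_line (\<lambda>t. of_real (1 / cmod \<kappa>) * f t)" 
    using f by (rule integrable_mult_right)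
  show "AE t in half_line. norm (green \<kappa> x t * f t) \<le> norm (complex_of_real (1 / cmod \<kappa>) * f t)"
    unfolding norm_mult norm_of_real
    using norm_green_le_inverse[OF x _ \<kappa>] by (intro AE_I2 mult_right_mono) auto
  show "(\<lambda>t. green \<kappa> x t * f t) \<in> borel_measurable half_line" by measurable
qed

lemma norm_green_op_le:
  assumes f: "integrable half_line f" and \<kappa>: "0 \<le> Im \<kappa>" and x: "0 \<le> x"
  shows "cmod (green_op \<kappa> f x) \<le> 1 / cmod \<kappa> * (LINT t|half_line. cmod (f t))"
proof -
  have "cmod (green_op \<kappa> f x) \<le> (LINT t|half_line. cmod (green \<kappa> x t * f t))"
    unfolding green_op_def by (rule integral_norm_bound)
  also have "\<dots> \<le> (LINT t|half_line. 1 / cmod \<kappa> * cmod (f t))"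
    using norm_green_le_inverse[OF x _ \<kappa>] f
    unfolding norm_mult by (intro integral_mono' integrable_mult_right mult_right_mono) auto
  finally show ?thesis by simp
qed

lemma integrable_green_op_mult:
  assumes f: "integrable half_line f" and g: "integrable half_line g" and \<kappa>: "0 \<le> Im \<kappa>"
  shows "integrable half_line (\<lambda>x. green_op \<kappa> f x * cnj (g x))"
proof (rule Bochner_Integration.integrable_bound)
  let ?B = "1 / cmod \<kappa> * (LINT t|half_line. cmod (f t))"
  show "integrable half_line (\<lambda>x. of_real ?B * g x)"
    using g by (rule integrable_mult_right)
  have "cmod (green_op \<kappa> f x) \<le> \<bar>?B\<bar>" if "0 < x" for x
    using order_trans[OF norm_green_op_le[OF f \<kappa>] abs_ge_self] that by simp
  then show "AE x in half_line. norm (green_op \<kappa> f x * cnj (g x)) \<le> norm (of_real ?B * g x)"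
    unfolding norm_mult norm_of_real complex_mod_cnj by (intro AE_I2 mult_right_mono) auto
  show "(\<lambda>x. green_op \<kappa> f x * cnj (g x)) \<in> borel_measurable half_line"
    by (rule borel_measurable_times[OF borel_measurable_green_op[OF f] borel_measurable_integrable[OF integrable_cnj[OF g]]])
qed

lemma green_op_diff_sum:
  assumes f: "integrable half_line f" and g: "\<And>s. s \<in> A \<Longrightarrow> integrable half_line (g s)"
    and \<kappa>: "0 \<le> Im \<kappa>" and x: "0 \<le> x"
  shows "green_op \<kappa> (\<lambda>x. f x - (\<Sum>s\<in>A. c s * g s x)) x = green_op \<kappa> f x - (\<Sum>s\<in>A. c s * green_op \<kappa> (g s) x)"
proof -
  have "green_op \<kappa> (\<lambda>x. f x - (\<Sum>s\<in>A. c s * g s x)) x =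
      (LINT t|half_line. green \<kappa> x t * f t - (\<Sum>s\<in>A. c s * (green \<kappa> x t * g s t)))"
    unfolding green_op_def
    by (intro Bochner_Integration.integral_cong) (auto simp: algebra_simps sum_distrib_left)
  also have "\<dots> = green_op \<kappa> f x - (\<Sum>s\<in>A. c s * green_op \<kappa> (g s) x)"
  proof (subst Bochner_Integration.integral_diff)
    show "integrable half_line (\<lambda>t. \<Sum>s\<in>A. c s * (green \<kappa> x t * g s t))"
      by (intro Bochner_Integration.integrable_sum integrable_mult_right integrable_green_mult g \<kappa> x)
    have "(LINT t|half_line. (\<Sum>s\<in>A. c s * (green \<kappa> x t * g s t))) =
        (\<Sum>s\<in>A. (LINT t|half_line. c s * (green \<kappa> x t * g s t)))"
      by (intro Bochner_Integration.integral_sum integrable_mult_right integrable_green_mult g \<kappa> x)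
    then show "(LINT t|half_line. green \<kappa> x t * f t) - (LINT t|half_line. (\<Sum>s\<in>A. c s * (green \<kappa> x t * g s t))) =
        green_op \<kappa> f x - (\<Sum>s\<in>A. c s * green_op \<kappa> (g s) x)"
      by (simp add: green_op_def)
  qed (rule integrable_green_mult[OF f \<kappa> x])
  finally show ?thesis .
qed

text \<open>Linearity of the Green operator inside the inner product. Agreement is demanded on the
  closed half-line only, since a function chosen by \<open>resolvent_L\<close> is determined only
  there.\<close>

lemma L2_ip_green_op_diff_sum:
  assumes f: "integrable half_line f" and g: "\<And>s. s \<in> A \<Longrightarrow> integrable half_line (g s)"
    and h: "integrable half_line h" and \<kappa>: "0 \<le> Im \<kappa>"
    and y: "\<And>x. 0 \<le> x \<Longrightarrow> y x = green_op \<kappa> (\<lambda>x. f x - (\<Sum>s\<in>A. c s * g s x)) x"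
  shows "L2_ip y h = L2_ip (green_op \<kappa> f) h - (\<Sum>s\<in>A. c s * L2_ip (green_op \<kappa> (g s)) h)"
proof -
  have "L2_ip y h =
      (LINT x|half_line. green_op \<kappa> f x * cnj (h x) - (\<Sum>s\<in>A. c s * (green_op \<kappa> (g s) x * cnj (h x))))"
    unfolding L2_ip_def
    by (intro Bochner_Integration.integral_cong)
      (auto simp: y green_op_diff_sum[OF f g \<kappa>] left_diff_distrib sum_distrib_right mult.assoc)
  also have "\<dots> = L2_ip (green_op \<kappa> f) h - (\<Sum>s\<in>A. c s * L2_ip (green_op \<kappa> (g s)) h)"
  proof (subst Bochner_Integration.integral_diff)
    show "integrable half_line (\<lambda>x. \<Sum>s\<in>A. c s * (green_op \<kappa> (g s) x * cnj (h x)))"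
      by (intro Bochner_Integration.integrable_sum integrable_mult_right integrable_green_op_mult g h \<kappa>)
    have "(LINT x|half_line. (\<Sum>s\<in>A. c s * (green_op \<kappa> (g s) x * cnj (h x)))) =
        (\<Sum>s\<in>A. (LINT x|half_line. c s * (green_op \<kappa> (g s) x * cnj (h x))))"
      by (intro Bochner_Integration.integral_sum integrable_mult_right integrable_green_op_mult g h \<kappa>)
    then show "(LINT x|half_line. green_op \<kappa> f x * cnj (h x)) -
        (LINT x|half_line. (\<Sum>s\<in>A. c s * (green_op \<kappa> (g s) x * cnj (h x)))) =
        L2_ip (green_op \<kappa> f) h - (\<Sum>s\<in>A. c s * L2_ip (green_op \<kappa> (g s)) h)"
      by (simp add: L2_ip_def)
  qed (rule integrable_green_op_mult[OF f h \<kappa>])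
  finally show ?thesis .
qed

text \<open>Moving the finite-rank part to the right leaves an equation for the unperturbed
  operator, whose solution is unique. The result is implicit in \<open>y\<close>: it leads to a
  linear system for the numbers \<open>L2_ip y (v s)\<close>.\<close>

lemma resolvent_equation_unique:
  assumes \<kappa>: "0 < Im \<kappa>" and v: "\<And>s. s \<in> {1..m} \<Longrightarrow> L12_fun (v s)" and f: "L12_fun f"
    and y: "y \<in> dom_L" and eq: "AE x in half_line. op_L \<alpha> v m y x - \<kappa>\<^sup>2 * y x = f x"
    and x: "0 \<le> x"
  shows "y x = green_op \<kappa> (\<lambda>x. f x - (\<Sum>s=1..m. of_real (\<alpha> s) * L2_ip y (v s) * v s x)) x"
proof -
  define w where "w x = f x - (\<Sum>s=1..m. of_real (\<alpha> s) * L2_ip y (v s) * v s x)" for x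
  have w: "L12_fun w"
    unfolding w_def[abs_def] by (intro L12_fun_diff f L12_fun_sum v)
  note g = W22_green_op[OF \<kappa> w]
  obtain y1 where y1: "W22_derivs y y1 (second_deriv y)"
    using someI_ex[of "\<lambda>y2. \<exists>y1. W22_derivs y y1 y2"] y unfolding second_deriv_def dom_L_def by blast
  have "y x - green_op \<kappa> w x = 0"
  proof (rule helmholtz_unique[OF \<kappa> W22_diff[OF y1 g(1)] _ _ x])
    show "y 0 - green_op \<kappa> w 0 = 0"
      using y g(3) by (simp add: dom_L_def)
    show "AE x in half_line. second_deriv y x - (- \<kappa>\<^sup>2 * green_op \<kappa> w x - w x) =
        - \<kappa>\<^sup>2 * (y x - green_op \<kappa> w x)"
      using eq by eventually_elim (simp add: op_L_def w_def algebra_simps)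
  qed
  then show ?thesis by (simp add: w_def[abs_def])
qed

text \<open>The converse: coefficients \<open>c\<close> that reproduce themselves as inner products
  of \<open>y\<close> yield a genuine solution.\<close>

lemma resolvent_equation_exists:
  assumes \<kappa>: "0 < Im \<kappa>" and v: "\<And>s. s \<in> {1..m} \<Longrightarrow> L12_fun (v s)" and f: "L12_fun f"
    and y: "y = green_op \<kappa> (\<lambda>x. f x - (\<Sum>s=1..m. of_real (\<alpha> s) * c s * v s x))"
    and c: "\<And>s. s \<in> {1..m} \<Longrightarrow> L2_ip y (v s) = c s"
  shows "y \<in> dom_L" and "AE x in half_line. op_L \<alpha> v m y x - \<kappa>\<^sup>2 * y x = f x"
proof -
  define w where "w x = f x - (\<Sum>s=1..m. of_real (\<alpha> s) * c s * v s x)" for x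
  have w: "L12_fun w"
    unfolding w_def[abs_def] by (intro L12_fun_diff f L12_fun_sum v)
  have yw: "y = green_op \<kappa> w" by (simp add: y w_def[abs_def])
  note g = W22_green_op[OF \<kappa> w, folded yw]
  show "y \<in> dom_L" using g by (auto simp: dom_L_def)
  show "AE x in half_line. op_L \<alpha> v m y x - \<kappa>\<^sup>2 * y x = f x"
    using second_deriv_AE[OF g(1)] by eventually_elim (simp add: op_L_def w_def c)
qed

section \<open>Perturbation determinants and their recursion\<close>

definition gram :: "(nat \<Rightarrow> real \<Rightarrow> complex) \<Rightarrow> complex \<Rightarrow> nat \<Rightarrow> nat \<Rightarrow> complex" where
  "gram v \<kappa> s j = L2_ip (green_op \<kappa> (v s)) (v j)"

definition perturb_entry :: "(nat \<Rightarrow> real) \<Rightarrow> (nat \<Rightarrow> real \<Rightarrow> complex) \<Rightarrow> complex \<Rightarrow> nat \<Rightarrow> nat \<Rightarrow> complex" where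
  "perturb_entry \<alpha> v \<kappa> j s = (if s = j then 1 else 0) + of_real (\<alpha> (s + 1)) * gram v \<kappa> (s + 1) (j + 1)"

text \<open>The perturbation determinant of the pair \<open>{L\<^sub>m, L\<^sub>0}\<close> at the spectral parameter \<open>\<kappa>\<^sup>2\<close>.\<close>

definition perturb_det :: "(nat \<Rightarrow> real) \<Rightarrow> (nat \<Rightarrow> real \<Rightarrow> complex) \<Rightarrow> nat \<Rightarrow> complex \<Rightarrow> complex" where
  "perturb_det \<alpha> v m \<kappa> = Determinant.det (mat m m (\<lambda>(j, s). perturb_entry \<alpha> v \<kappa> j s))"

lemma sum_atLeast1_atMost_shift: "(\<Sum>s=1..m. f s) = (\<Sum>s<m. f (s + 1 :: nat))"
  by (rule sum.reindex_bij_witness[of _ "\<lambda>s. s + 1" "\<lambda>s. s - 1"]) auto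

text \<open>The numbers \<open>L2_ip y (v s)\<close> for the resolvent \<open>y\<close> of
  \<open>v (Suc m)\<close> solve, up to a factor, the linear system whose right-hand side is the new
  last column. So \<open>det_border\<close> applies and the Schur complement is
  \<open>b_fun\<close>.\<close>

lemma perturb_det_Suc:
  assumes \<kappa>: "0 < Im \<kappa>" and v: "\<And>s. s \<in> {1..Suc m} \<Longrightarrow> L12_fun (v s)"
    and nz: "perturb_det \<alpha> v m \<kappa> \<noteq> 0"
  shows "perturb_det \<alpha> v (Suc m) \<kappa> = b_fun \<alpha> v (Suc m) (\<kappa>\<^sup>2) * perturb_det \<alpha> v m \<kappa>"
proof -
  have vint: "integrable half_line (v s)" if "s \<in> {1..Suc m}" for s
    using v[OF that] by (simp add: L12_fun_def)
  have v': "L12_fun (v s)" if "s \<in> {1..m}" for s using v that by simp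
  have vS: "L12_fun (v (Suc m))" by (rule v) simp
  have \<kappa>': "0 \<le> Im \<kappa>" using \<kappa> by simp
  have entry_sum: "(\<Sum>s<m. perturb_entry \<alpha> v \<kappa> i s * x s) =
      (if i < m then x i else 0) + (\<Sum>s<m. of_real (\<alpha> (s + 1)) * x s * gram v \<kappa> (s + 1) (i + 1))" for i x
    by (simp add: perturb_entry_def algebra_simps sum.distrib if_distrib[where f = "\<lambda>y. _ * y"] cong: if_cong)
  have ip: "L2_ip y (v (i + 1)) = gram v \<kappa> (Suc m) (i + 1) -
      (\<Sum>s<m. of_real (\<alpha> (s + 1)) * c (s + 1) * gram v \<kappa> (s + 1) (i + 1))"
    if "\<And>x. 0 \<le> x \<Longrightarrow> y x = green_op \<kappa> (\<lambda>x. v (Suc m) x - (\<Sum>s=1..m. of_real (\<alpha> s) * c s * v s x)) x"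
      and "i < Suc m" for y c i
  proof -
    have "L2_ip y (v (i + 1)) = L2_ip (green_op \<kappa> (v (Suc m))) (v (i + 1)) -
        (\<Sum>s=1..m. of_real (\<alpha> s) * c s * L2_ip (green_op \<kappa> (v s)) (v (i + 1)))"
      by (rule L2_ip_green_op_diff_sum[OF _ _ _ \<kappa>' that(1)]) (use vint that(2) in auto)
    then show ?thesis unfolding sum_atLeast1_atMost_shift gram_def .
  qed
  \<comment> \<open>The nonvanishing determinant supplies the coefficients of a solution, which
    shows that the choice made by \<open>resolvent_L\<close> is not void.\<close>
  obtain x where x: "\<And>i. i < m \<Longrightarrow> (\<Sum>s<m. perturb_entry \<alpha> v \<kappa> i s * x s) = gram v \<kappa> (Suc m) (i + 1)"
    by (rule det_nonzero_solve[OF nz[unfolded perturb_det_def], where c = "\<lambda>i. gram v \<kappa> (Suc m) (i + 1)"])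
      (rule that)
  define P where "P y \<longleftrightarrow> y \<in> dom_L \<and> (AE x in half_line. op_L \<alpha> v m y x - \<kappa>\<^sup>2 * y x = v (Suc m) x)" for y
  \<comment> \<open>Matrix indices start at 0 and those of \<open>v\<close> at 1, hence
    \<open>x (s - 1)\<close>.\<close>
  define y0 where "y0 = green_op \<kappa> (\<lambda>t. v (Suc m) t - (\<Sum>s=1..m. of_real (\<alpha> s) * x (s - 1) * v s t))"
  have "L2_ip y0 (v s) = x (s - 1)" if "s \<in> {1..m}" for s
  proof -
    have s: "s - 1 < m" "s - 1 < Suc m" "s - 1 + 1 = s" using that by auto
    show ?thesis
      using ip[of y0 "\<lambda>s. x (s - 1)" "s - 1"] x[OF s(1)] s unfolding entry_sum
      by (simp add: y0_def diff_eq_eq)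
  qed
  then have "P y0"
    unfolding P_def using resolvent_equation_exists[OF \<kappa> v' vS y0_def] by simp
  define y where "y = resolvent_L \<alpha> v m (\<kappa>\<^sup>2) (v (Suc m))"
  have "P y"
    using someI[of P y0] \<open>P y0\<close> unfolding y_def resolvent_L_def P_def by blast
  then have y: "y t = green_op \<kappa> (\<lambda>t. v (Suc m) t - (\<Sum>s=1..m. of_real (\<alpha> s) * L2_ip y (v s) * v s t)) t"
    if "0 \<le> t" for t
    unfolding P_def using resolvent_equation_unique[OF \<kappa> v' vS] that by simp
  \<comment> \<open>The factor \<open>\<alpha> (Suc m)\<close> matches the one carried by the last
    column of the bordered matrix.\<close>
  define z where "z s = of_real (\<alpha> (Suc m)) * L2_ip y (v (s + 1))" for s
  have ipy: "z i = of_real (\<alpha> (Suc m)) * gram v \<kappa> (Suc m) (i + 1) -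
      (\<Sum>s<m. of_real (\<alpha> (s + 1)) * z s * gram v \<kappa> (s + 1) (i + 1))" if "i < Suc m" for i
    unfolding z_def using ip[OF y that]
    by (simp add: right_diff_distrib sum_distrib_left mult_ac)
  have "perturb_det \<alpha> v (Suc m) \<kappa> = (perturb_entry \<alpha> v \<kappa> m m - (\<Sum>s<m. perturb_entry \<alpha> v \<kappa> m s * z s)) *
      perturb_det \<alpha> v m \<kappa>"
    unfolding perturb_det_def
  proof (rule det_border)
    fix i assume i: "i < m"
    then show "perturb_entry \<alpha> v \<kappa> i m = (\<Sum>s<m. perturb_entry \<alpha> v \<kappa> i s * z s)"
      using ipy[of i] unfolding entry_sum by (simp add: perturb_entry_def)
  qed
  \<comment> \<open>By \<open>ipy\<close> at index \<open>m\<close> the Schur complement equals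
    \<open>1 + z m\<close>.\<close>
  also have "perturb_entry \<alpha> v \<kappa> m m - (\<Sum>s<m. perturb_entry \<alpha> v \<kappa> m s * z s) = b_fun \<alpha> v (Suc m) (\<kappa>\<^sup>2)"
    using ipy[of m] unfolding entry_sum by (simp add: perturb_entry_def b_fun_def y_def[symmetric] z_def)
  finally show ?thesis .
qed

section \<open>Conjugation symmetry\<close>

text \<open>Replacing \<kappa> by \<open>- cnj \<kappa>\<close> conjugates i \<kappa>. As the kernel
  is symmetric, the arguments can be swapped, which displays the kernel of the adjoint.\<close>

lemma green_reflect_conj: "green (- cnj \<kappa>) x t = cnj (green \<kappa> t x)"
proof -
  have "exp (\<i> * (- cnj \<kappa>) * of_real r) = cnj (exp (\<i> * \<kappa> * of_real r))" for r
    by (simp add: exp_cnj)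
  moreover have "\<i> / (2 * (- cnj \<kappa>)) = cnj (\<i> / (2 * \<kappa>))"
    by simp
  ultimately show ?thesis
    unfolding green_def by (simp only: complex_cnj_mult complex_cnj_diff abs_minus_commute[of x t] add.commute[of x t])
qed

text \<open>Symmetry of the resolvent of \<open>L\<^sub>0\<close>: passing from \<open>\<kappa>\<close> to \<open>- cnj \<kappa>\<close> conjugates \<open>\<kappa>\<^sup>2\<close>.\<close>

lemma gram_reflect_conj:
  assumes vs: "integrable half_line (v s)" and vj: "integrable half_line (v j)" and \<kappa>: "0 \<le> Im \<kappa>"
  shows "gram v (- cnj \<kappa>) s j = cnj (gram v \<kappa> j s)"
proof -
  interpret P: pair_sigma_finite half_line half_line
    by (rule pair_sigma_finite_lebesgue_on) auto
  have meas: "(\<lambda>(x, t). cnj (green \<kappa> t x)) \<in> borel_measurable (half_line \<Otimes>\<^sub>M half_line)"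
    unfolding green_reflect_conj[symmetric] by (simp add: case_prod_unfold)
  \<comment> \<open>Only the bound \<open>1 / cmod \<kappa>\<close> is used, not exponential decay,
    so Fubini also covers real \<kappa>.\<close>
  have int: "integrable (half_line \<Otimes>\<^sub>M half_line) (\<lambda>(x, t). cnj (green \<kappa> t x) * (cnj (v j x) * v s t))"
  proof (rule Bochner_Integration.integrable_bound)
    let ?B = "1 / cmod \<kappa>"
    have prod: "integrable (half_line \<Otimes>\<^sub>M half_line) (\<lambda>(x, t). cnj (v j x) * v s t)"
      by (rule integrable_prod_mult[OF pair_sigma_finite_lebesgue_on integrable_cnj[OF vj] vs]) auto
    then show "integrable (half_line \<Otimes>\<^sub>M half_line) (\<lambda>p. of_real ?B * (case p of (x, t) \<Rightarrow> cnj (v j x) * v s t))"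
      by (rule integrable_mult_right)
    show "AE p in half_line \<Otimes>\<^sub>M half_line. norm (case p of (x, t) \<Rightarrow> cnj (green \<kappa> t x) * (cnj (v j x) * v s t))
        \<le> norm (of_real ?B * (case p of (x, t) \<Rightarrow> cnj (v j x) * v s t))"
    proof (rule AE_I2, clarify)
      fix x t assume "(x, t) \<in> space (half_line \<Otimes>\<^sub>M half_line)"
      then have "cmod (green \<kappa> t x) \<le> \<bar>?B\<bar>"
        using norm_green_le_inverse[of t x \<kappa>] \<kappa> by (simp add: space_pair_measure)
      then show "norm (cnj (green \<kappa> t x) * (cnj (v j x) * v s t)) \<le> norm (complex_of_real ?B * (cnj (v j x) * v s t))"
        unfolding norm_mult norm_of_real complex_mod_cnj by (intro mult_right_mono) auto
    qed
    show "(\<lambda>(x, t). cnj (green \<kappa> t x) * (cnj (v j x) * v s t)) \<in> borel_measurable (half_line \<Otimes>\<^sub>M half_line)"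
      using borel_measurable_times[OF meas borel_measurable_integrable[OF prod]]
      by (simp add: case_prod_unfold)
  qed
  have inner: "(LINT x|half_line. cnj (green \<kappa> t x * v j x)) = cnj (green_op \<kappa> (v j) t)" for t
    unfolding green_op_def by (rule Bochner_Integration.integral_cnj)
  have "gram v (- cnj \<kappa>) s j =
      (LINT x|half_line. (LINT t|half_line. cnj (green \<kappa> t x) * v s t) * cnj (v j x))"
    by (simp add: gram_def L2_ip_def green_op_def green_reflect_conj)
  also have "\<dots> = (LINT x|half_line. (LINT t|half_line. cnj (green \<kappa> t x) * (cnj (v j x) * v s t)))"
    by (subst integral_mult_left_zero[symmetric]) (simp add: mult_ac)
  also have "\<dots> = (LINT t|half_line. (LINT x|half_line. cnj (green \<kappa> t x) * (cnj (v j x) * v s t)))"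
    using P.Fubini_integral[OF int] by simp
  also have "\<dots> = (LINT t|half_line. (LINT x|half_line. cnj (green \<kappa> t x * v j x)) * v s t)"
    by (subst integral_mult_left_zero[symmetric]) (simp add: mult_ac)
  also have "\<dots> = (LINT t|half_line. cnj (green_op \<kappa> (v j) t * cnj (v s t)))"
    unfolding inner by simp
  also have "\<dots> = cnj (gram v \<kappa> j s)"
    by (simp only: Bochner_Integration.integral_cnj gram_def L2_ip_def)
  finally show ?thesis .
qed

text \<open>With G the matrix of the \<open>gram\<close> entries and A the real diagonal matrix of
  the \<alpha>, the determinant is that of I + G A. Its adjoint is I + A G*, and conjugation by A
  turns this into I + G* A.\<close>

lemma perturb_det_reflect_conj:
  assumes v: "\<And>s. s \<in> {1..m} \<Longrightarrow> integrable half_line (v s)" and \<alpha>: "\<And>s. s \<in> {1..m} \<Longrightarrow> \<alpha> s \<noteq> 0"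
    and \<kappa>: "0 \<le> Im \<kappa>"
  shows "perturb_det \<alpha> v m (- cnj \<kappa>) = cnj (perturb_det \<alpha> v m \<kappa>)"
  unfolding perturb_det_def
proof (rule det_conj_similar[where d = "\<lambda>i. of_real (\<alpha> (i + 1))"])
  fix i j assume "i < m" "j < m"
  then show "perturb_entry \<alpha> v (- cnj \<kappa>) i j =
      cnj (perturb_entry \<alpha> v \<kappa> j i) * of_real (\<alpha> (j + 1)) / of_real (\<alpha> (i + 1))"
    using gram_reflect_conj[of v "j + 1" "i + 1", OF v v \<kappa>] \<alpha>
    by (auto simp: perturb_entry_def field_simps)
qed (use \<alpha> in auto)

subsection \<open>Boundary values\<close>

text \<open>Dominated convergence twice, along sequences: first in the Green operator, then in the
  inner product. The modulus of the spectral parameter is at least that of its real part, so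
  \<open>1 / \<bar>lam\<bar>\<close> bounds all kernels.\<close>

lemma gram_tendsto:
  assumes vs: "integrable half_line (v s)" and vj: "integrable half_line (v j)" and lam: "lam \<noteq> 0"
  shows "((\<lambda>\<epsilon>. gram v (of_real lam + \<i> * of_real \<epsilon>) s j) \<longlongrightarrow> gram v (of_real lam) s j) (at_right 0)"
  unfolding tendsto_at_iff_sequentially o_def
proof (intro allI impI)
  fix X :: "nat \<Rightarrow> real"
  assume X: "\<forall>i. X i \<in> {0<..} - {0}" and lim: "X \<longlonglongrightarrow> 0"
  define K where "K n = of_real lam + \<i> * of_real (X n)" for n
  have Im: "0 \<le> Im (K n)" for n using X by (auto simp: K_def intro: less_imp_le)
  have "\<bar>lam\<bar> \<le> cmod (K n)" for n
    using abs_Re_le_cmod[of "K n"] by (simp add: K_def)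
  then have inv: "1 / cmod (K n) \<le> 1 / \<bar>lam\<bar>" for n
    using lam by (intro frac_le) auto
  have K: "K \<longlonglongrightarrow> of_real lam"
  proof -
    have "K \<longlonglongrightarrow> of_real lam + \<i> * of_real 0"
      unfolding K_def by (intro tendsto_intros lim)
    then show ?thesis by simp
  qed
  have green_lim: "(\<lambda>n. green (K n) x t) \<longlonglongrightarrow> green (of_real lam) x t" for x t
    unfolding green_def by (intro tendsto_intros K) (use lam in auto)
  have op_lim: "(\<lambda>n. green_op (K n) (v s) x) \<longlonglongrightarrow> green_op (of_real lam) (v s) x" if x: "0 < x" for x
    unfolding green_op_def
  proof (rule integral_dominated_convergence[where w = "\<lambda>t. 1 / \<bar>lam\<bar> * cmod (v s t)"])
    show "integrable half_line (\<lambda>t. 1 / \<bar>lam\<bar> * cmod (v s t))"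
      using vs by (intro integrable_mult_right) simp
    show "AE t in half_line. (\<lambda>n. green (K n) x t * v s t) \<longlonglongrightarrow> green (of_real lam) x t * v s t"
      by (intro AE_I2 tendsto_intros green_lim)
    have "cmod (green (K n) x t) \<le> 1 / \<bar>lam\<bar>" if "0 < t" for t n
      using order_trans[OF norm_green_le_inverse[OF _ _ Im] inv, of x t] x that by simp
    then show "AE t in half_line. norm (green (K n) x t * v s t) \<le> 1 / \<bar>lam\<bar> * cmod (v s t)" for n
      unfolding norm_mult by (intro AE_I2 mult_right_mono) auto
    show "(\<lambda>t. green (K n) x t * v s t) \<in> borel_measurable half_line" for n
      using x by (intro borel_measurable_integrable integrable_green_mult vs Im) simp
    show "(\<lambda>t. green (of_real lam) x t * v s t) \<in> borel_measurable half_line"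
      using x by (intro borel_measurable_integrable integrable_green_mult vs) auto
  qed
  let ?B = "1 / \<bar>lam\<bar> * (LINT t|half_line. cmod (v s t))"
  have "(\<lambda>n. gram v (K n) s j) \<longlonglongrightarrow> gram v (of_real lam) s j"
    unfolding gram_def L2_ip_def
  proof (rule integral_dominated_convergence[where w = "\<lambda>x. ?B * cmod (v j x)"])
    show "integrable half_line (\<lambda>x. ?B * cmod (v j x))"
      using vj by (intro integrable_mult_right) simp
    show "AE x in half_line. (\<lambda>n. green_op (K n) (v s) x * cnj (v j x)) \<longlonglongrightarrow> green_op (of_real lam) (v s) x * cnj (v j x)"
      by (intro AE_I2 tendsto_intros op_lim) simp
    have "cmod (green_op (K n) (v s) x) \<le> ?B" if "0 < x" for x n
    proof -
      have "cmod (green_op (K n) (v s) x) \<le> 1 / cmod (K n) * (LINT t|half_line. cmod (v s t))"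
        using that by (intro norm_green_op_le vs Im) simp
      also have "\<dots> \<le> ?B"
        by (intro mult_right_mono inv integral_nonneg_AE) auto
      finally show ?thesis .
    qed
    then show "AE x in half_line. norm (green_op (K n) (v s) x * cnj (v j x)) \<le> ?B * cmod (v j x)" for n
      unfolding norm_mult complex_mod_cnj by (intro AE_I2 mult_right_mono) auto
    show "(\<lambda>x. green_op (K n) (v s) x * cnj (v j x)) \<in> borel_measurable half_line" for n
      by (intro borel_measurable_integrable integrable_green_op_mult vs vj Im)
    show "(\<lambda>x. green_op (of_real lam) (v s) x * cnj (v j x)) \<in> borel_measurable half_line"
      by (intro borel_measurable_integrable integrable_green_op_mult vs vj) simp
  qed
  then show "(\<lambda>n. gram v (of_real lam + \<i> * of_real (X n)) s j) \<longlonglongrightarrow> gram v (of_real lam) s j"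
    by (simp add: K_def)
qed

lemma perturb_det_tendsto:
  assumes v: "\<And>s. s \<in> {1..m} \<Longrightarrow> integrable half_line (v s)" and lam: "lam \<noteq> 0"
  shows "((\<lambda>\<epsilon>. perturb_det \<alpha> v m (of_real lam + \<i> * of_real \<epsilon>)) \<longlongrightarrow> perturb_det \<alpha> v m (of_real lam)) (at_right 0)"
  unfolding perturb_det_def perturb_entry_def
  by (intro tendsto_det tendsto_intros gram_tendsto v lam) auto

section \<open>The real axis and the Jost solution\<close>

text \<open>At a real parameter the formula valid for \<open>t \<le> x\<close> is continued to all
  \<open>t\<close>, which gives a kernel of rank one; the correction for \<open>x < t\<close> is the
  kernel of \<open>psi\<close>.\<close>

lemma green_real:
  assumes lam: "lam \<noteq> 0"
  shows "green (of_real lam) x t = exp (\<i> * of_real lam * of_real x) * of_real (sin (lam * t) / lam) -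
    (if x < t then of_real (sin (lam * (t - x)) / lam) else 0)"
proof -
  have sin: "of_real (sin y) = (exp (\<i> * of_real y) - exp (- (\<i> * of_real y))) / (2 * \<i>)" for y :: real
    unfolding sin_of_real[symmetric] sin_exp_eq by (simp add: field_simps)
  show ?thesis
    using lam by (simp add: green_def sin field_simps exp_add[symmetric] exp_diff)
qed

lemma green_op_real:
  assumes lam: "lam \<noteq> 0" and f: "integrable half_line f" and x: "0 \<le> x"
  shows "green_op (of_real lam) f x = exp (\<i> * of_real lam * of_real x) * psi f lam 0 - psi f lam x"
proof -
  have [measurable]: "f \<in> borel_measurable half_line" using f by auto
  have bound: "\<bar>sin y / lam\<bar> \<le> \<bar>1 / \<bar>lam\<bar>\<bar>" for y
    unfolding abs_divide abs_abs abs_one by (intro divide_right_mono) auto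
  have int: "integrable half_line (\<lambda>t. of_real (sin (lam * (t - y)) / lam) * f t)" for y
  proof (rule Bochner_Integration.integrable_bound)
    show "integrable half_line (\<lambda>t. of_real (1 / \<bar>lam\<bar>) * f t)"
      using f by (rule integrable_mult_right)
    show "AE t in half_line. norm (of_real (sin (lam * (t - y)) / lam) * f t) \<le> norm (complex_of_real (1 / \<bar>lam\<bar>) * f t)"
      unfolding norm_mult norm_of_real by (intro AE_I2 mult_right_mono bound) simp
  qed measurable
  have psi_x: "psi f lam x = (LINT t|half_line. (if t \<in> {x<..} then of_real (sin (lam * (t - x)) / lam) * f t else 0))"
    using x unfolding psi_def by (subst Lebesgue_Measure.integral_restrict_Int) (auto simp: Int_absorb2)
  have ind: "integrable half_line (\<lambda>t. if t \<in> {x<..} then of_real (sin (lam * (t - x)) / lam) * f t else 0)"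
    by (rule Bochner_Integration.integrable_bound[OF int[of x]]) (auto intro!: measurable_If)
  have "exp (\<i> * of_real lam * of_real x) * psi f lam 0 - psi f lam x =
     (LINT t|half_line. exp (\<i> * of_real lam * of_real x) * (of_real (sin (lam * (t - 0)) / lam) * f t) -
       (if t \<in> {x<..} then of_real (sin (lam * (t - x)) / lam) * f t else 0))"
    unfolding psi_x by (subst Bochner_Integration.integral_diff[OF integrable_mult_right[OF int[of 0]] ind])
      (simp only: integral_mult_right_zero psi_def)
  also have "\<dots> = green_op (of_real lam) f x"
    unfolding green_op_def
    by (intro Bochner_Integration.integral_cong) (auto simp: green_real[OF lam] algebra_simps)
  finally show ?thesis ..
qed

text \<open>Pairing \<open>green_op_real\<close> with \<open>v j\<close> turns the exponential into
  \<open>v_tilde_star\<close> and the \<open>psi\<close> term into \<open>phi\<close>.\<close>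

lemma gram_real:
  assumes lam: "lam \<noteq> 0" and vs: "integrable half_line (v s)" and vj: "integrable half_line (v j)"
  shows "gram v (of_real lam) s j = psi (v s) lam 0 * v_tilde_star (v j) lam - phi v s j lam"
proof -
  have [measurable]: "v j \<in> borel_measurable half_line" using vj by auto
  let ?e = "\<lambda>x. exp (\<i> * of_real lam * of_real x)"
  have e: "integrable half_line (\<lambda>x. ?e x * cnj (v j x))"
  proof (rule Bochner_Integration.integrable_bound)
    show "integrable half_line (\<lambda>x. cnj (v j x))" using vj by simp
    show "(\<lambda>x. ?e x * cnj (v j x)) \<in> borel_measurable half_line"
      by (rule borel_measurable_times[OF _ borel_measurable_integrable[OF integrable_cnj[OF vj]]]) measurable
  qed (auto simp: norm_mult)
  have g: "integrable half_line (\<lambda>x. green_op (of_real lam) (v s) x * cnj (v j x))"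
    by (intro integrable_green_op_mult vs vj) simp
  have "phi v s j lam = (LINT x|half_line. psi (v s) lam 0 * (?e x * cnj (v j x)) -
      green_op (of_real lam) (v s) x * cnj (v j x))"
    unfolding phi_def
    by (intro Bochner_Integration.integral_cong) (auto simp: green_op_real[OF lam vs] algebra_simps)
  also have "\<dots> = psi (v s) lam 0 * (LINT x|half_line. ?e x * cnj (v j x)) - gram v (of_real lam) s j"
    using e g by (simp add: gram_def L2_ip_def)
  also have "(LINT x|half_line. ?e x * cnj (v j x)) = v_tilde_star (v j) lam"
    unfolding v_tilde_star_def v_tilde_def Bochner_Integration.integral_cnj[symmetric]
    by (intro Bochner_Integration.integral_cong) (simp_all add: exp_cnj)
  finally show ?thesis by simp
qed

text \<open>At \<open>x = 0\<close> the definition of \<open>jost\<close> is the expansion in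
  \<open>det_rank_one_update\<close>. The rank-one term completes each \<open>phi\<close> to minus a
  \<open>gram\<close> entry, so the updated matrix is the negative of the perturbation matrix; this
  gives the sign.\<close>

lemma jost_zero_eq_perturb_det:
  assumes lam: "lam \<noteq> 0" and v: "\<And>s. s \<in> {1..n} \<Longrightarrow> integrable half_line (v s)"
  shows "jost n \<alpha> v lam 0 = (- 1) ^ n * perturb_det \<alpha> v n (of_real lam)"
proof -
  define M where "M = M_mat n \<alpha> v lam"
  define u where "u k = v_tilde_star (v (k + 1)) lam" for k
  define w where "w s = of_real (\<alpha> (s + 1)) * psi (v (s + 1)) lam 0" for s
  have M: "M \<in> carrier_mat n n" by (simp add: M_def M_mat_def)
  have "jost n \<alpha> v lam 0 = Determinant.det M - (\<Sum>j<n. w j * Determinant.det (replace_col M (Matrix.vec n u) j))"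
    unfolding jost_def sum_atLeast1_atMost_shift e_zero_def e_coeff_def
    by (simp add: M_def u_def[abs_def] w_def sum_negf[symmetric] mult_ac)
  also have "\<dots> = Determinant.det (mat n n (\<lambda>(i, j). M $$ (i, j) - u i * w j))"
    by (rule det_rank_one_update[OF M, symmetric])
  also have "mat n n (\<lambda>(i, j). M $$ (i, j) - u i * w j) =
      (- 1) \<cdot>\<^sub>m mat n n (\<lambda>(j, s). perturb_entry \<alpha> v (of_real lam) j s)"
    by (rule eq_matI)
      (auto simp: M_def M_mat_def u_def w_def perturb_entry_def gram_real[OF lam] v algebra_simps)
  finally show ?thesis
    by (simp add: perturb_det_def)
qed

section \<open>Product formula and passage to the boundary\<close>

text \<open>Nonvanishing is assumed for the determinants rather than for the factors, because near
  \<open>- lam\<close> it is known only for the determinants.\<close>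

lemma perturb_det_eq_prod:
  assumes \<kappa>: "0 < Im \<kappa>" and v: "\<And>s. s \<in> {1..n} \<Longrightarrow> L12_fun (v s)"
    and nz: "\<And>m. m < n \<Longrightarrow> perturb_det \<alpha> v m \<kappa> \<noteq> 0" and "m \<le> n"
  shows "perturb_det \<alpha> v m \<kappa> = (\<Prod>k=1..m. b_fun \<alpha> v k (\<kappa>\<^sup>2))"
  using \<open>m \<le> n\<close>
proof (induction m)
  case 0
  then show ?case by (simp add: perturb_det_def)
next
  case (Suc m)
  then show ?case
    using perturb_det_Suc[where m = m and \<alpha> = \<alpha>, OF \<kappa> v nz] by (simp add: mult.commute)
qed

text \<open>The recursion starts from the empty determinant 1, and each step multiplies by a nonzero
  factor; nonvanishing at \<open>m\<close> is what permits the step to \<open>Suc m\<close>.\<close>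

lemma perturb_det_nonzero:
  assumes \<kappa>: "0 < Im \<kappa>" and v: "\<And>s. s \<in> {1..n} \<Longrightarrow> L12_fun (v s)"
    and b: "\<And>k. k \<in> {1..n} \<Longrightarrow> b_fun \<alpha> v k (\<kappa>\<^sup>2) \<noteq> 0" and "m \<le> n"
  shows "perturb_det \<alpha> v m \<kappa> \<noteq> 0"
  using \<open>m \<le> n\<close>
proof (induction m)
  case 0
  then show ?case by (simp add: perturb_det_def)
next
  case (Suc m)
  then show ?case
    using perturb_det_Suc[where m = m and \<alpha> = \<alpha>, OF \<kappa> v] b[of "Suc m"] by simp
qed

lemma b_bv_tendsto:
  assumes "b_bv_exists \<alpha> v k lam"
  shows "((\<lambda>\<epsilon>. b_fun \<alpha> v k ((of_real lam + \<i> * of_real \<epsilon>)\<^sup>2)) \<longlongrightarrow> b_bv \<alpha> v k lam) (at_right 0)"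
  using assms unfolding b_bv_exists_def b_bv_def
  by (metis tendsto_Lim trivial_limit_at_right_real)

text \<open>Both sides are limits of the same function of \<epsilon>: the determinant extends
  continuously to the axis, and off the axis it is the product of the \<open>b_fun\<close>.\<close>

lemma boundary_perturb_det:
  assumes v: "\<And>s. s \<in> {1..n} \<Longrightarrow> L12_fun (v s)" and lam: "lam \<noteq> 0"
    and bv: "\<And>k. k \<in> {1..n} \<Longrightarrow> b_bv_exists \<alpha> v k lam"
    and nz: "eventually (\<lambda>\<epsilon>. \<forall>m<n. perturb_det \<alpha> v m (of_real lam + \<i> * of_real \<epsilon>) \<noteq> 0) (at_right 0)"
  shows "perturb_det \<alpha> v n (of_real lam) = (\<Prod>k=1..n. b_bv \<alpha> v k lam)"
proof (rule tendsto_unique[OF trivial_limit_at_right_real])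
  show "((\<lambda>\<epsilon>. perturb_det \<alpha> v n (of_real lam + \<i> * of_real \<epsilon>)) \<longlongrightarrow> perturb_det \<alpha> v n (of_real lam)) (at_right 0)"
    using v lam by (intro perturb_det_tendsto) (auto simp: L12_fun_def)
  have "((\<lambda>\<epsilon>. \<Prod>k=1..n. b_fun \<alpha> v k ((of_real lam + \<i> * of_real \<epsilon>)\<^sup>2)) \<longlongrightarrow> (\<Prod>k=1..n. b_bv \<alpha> v k lam)) (at_right 0)"
    by (intro tendsto_prod b_bv_tendsto bv)
  moreover have "\<forall>\<^sub>F \<epsilon> in at_right 0. (\<Prod>k=1..n. b_fun \<alpha> v k ((of_real lam + \<i> * of_real \<epsilon>)\<^sup>2)) =
      perturb_det \<alpha> v n (of_real lam + \<i> * of_real \<epsilon>)"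
    using nz eventually_at_right_less[of 0]
    by eventually_elim (intro perturb_det_eq_prod[symmetric, where n = n] v, auto)
  ultimately show "((\<lambda>\<epsilon>. perturb_det \<alpha> v n (of_real lam + \<i> * of_real \<epsilon>)) \<longlongrightarrow> (\<Prod>k=1..n. b_bv \<alpha> v k lam)) (at_right 0)"
    by (rule Lim_transform_eventually)
qed

theorem theorem3p3:
  fixes n :: nat and \<alpha> :: "nat \<Rightarrow> real" and v :: "nat \<Rightarrow> real \<Rightarrow> complex" and lam :: real
  assumes alpha: "\<And>k. k \<in> {1..n} \<Longrightarrow> \<alpha> k \<noteq> 0"
    and v_meas: "\<And>k. k \<in> {1..n} \<Longrightarrow> v k \<in> borel_measurable half_line"
    and v_int: "\<And>k. k \<in> {1..n} \<Longrightarrow> integrable half_line (\<lambda>x. (1 + x\<^sup>2) * (cmod (v k x))\<^sup>2)"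
    and v_indep: "L2_lin_indep n v"
    and lam_nz: "lam \<noteq> 0"
    and bv_pos: "\<And>k. k \<in> {1..n} \<Longrightarrow> b_bv_exists \<alpha> v k lam"
    and bv_neg: "\<And>k. k \<in> {1..n} \<Longrightarrow> b_bv_exists \<alpha> v k (- lam)"
    and r_nz: "\<And>k. k \<in> {1..n} \<Longrightarrow> r_fun \<alpha> v k lam \<noteq> 0"
    and e_nz: "jost n \<alpha> v lam 0 \<noteq> 0"
  shows "scattering n \<alpha> v lam = (\<Prod>k=1..n. S_factor \<alpha> v k lam)"
proof -
  have v: "L12_fun (v s)" if "s \<in> {1..n}" for s
    using weighted_L12[OF v_meas[OF that] v_int[OF that]] .
  then have vint: "integrable half_line (v s)" if "s \<in> {1..n}" for s
    using that by (simp add: L12_fun_def)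
  have "b_bv \<alpha> v k lam \<noteq> 0" if "k \<in> {1..n}" for k
    using r_nz[OF that] by (auto simp: r_fun_def)
  \<comment> \<open>A nonzero boundary value keeps \<open>b_fun\<close> away from 0 for all small
    \<epsilon>, simultaneously for the finitely many \<open>k\<close>.\<close>
  then have "\<forall>\<^sub>F \<epsilon> in at_right 0. \<forall>k\<in>{1..n}. b_fun \<alpha> v k ((of_real lam + \<i> * of_real \<epsilon>)\<^sup>2) \<noteq> 0"
    using tendsto_imp_eventually_ne[OF b_bv_tendsto[OF bv_pos]]
    by (intro eventually_ball_finite) auto
  then have nz: "\<forall>\<^sub>F \<epsilon> in at_right 0. \<forall>m<n. perturb_det \<alpha> v m (of_real lam + \<i> * of_real \<epsilon>) \<noteq> 0"
    using eventually_at_right_less[of 0]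
  proof eventually_elim
    case (elim \<epsilon>)
    show ?case
    proof (intro allI impI)
      fix m assume "m < n"
      show "perturb_det \<alpha> v m (of_real lam + \<i> * of_real \<epsilon>) \<noteq> 0"
        by (rule perturb_det_nonzero[where n = n]) (use elim v \<open>m < n\<close> in auto)
    qed
  qed
  \<comment> \<open>Boundary values at \<open>- lam\<close> may be 0, so nonvanishing is transported
    from \<open>lam\<close>: the point \<open>- lam + \<i> * \<epsilon>\<close> is
    \<open>- cnj (lam + \<i> * \<epsilon>)\<close>.\<close>
  have nz': "\<forall>\<^sub>F \<epsilon> in at_right 0. \<forall>m<n. perturb_det \<alpha> v m (of_real (- lam) + \<i> * of_real \<epsilon>) \<noteq> 0"
    using nz eventually_at_right_less[of 0]
  proof eventually_elim
    case (elim \<epsilon>)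
    show ?case
    proof (intro allI impI)
      fix m assume m: "m < n"
      have "perturb_det \<alpha> v m (- cnj (of_real lam + \<i> * of_real \<epsilon>)) =
          cnj (perturb_det \<alpha> v m (of_real lam + \<i> * of_real \<epsilon>))"
        by (rule perturb_det_reflect_conj) (use m vint alpha elim in auto)
      then show "perturb_det \<alpha> v m (of_real (- lam) + \<i> * of_real \<epsilon>) \<noteq> 0"
        using elim m by simp
    qed
  qed
  \<comment> \<open>The signs \<open>(- 1) ^ n\<close> of numerator and denominator cancel.\<close>
  have "scattering n \<alpha> v lam = (\<Prod>k=1..n. b_bv \<alpha> v k (- lam)) / (\<Prod>k=1..n. b_bv \<alpha> v k lam)"
    unfolding scattering_def
    using jost_zero_eq_perturb_det[OF lam_nz vint] jost_zero_eq_perturb_det[of "- lam", OF _ vint]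
      boundary_perturb_det[OF v lam_nz bv_pos nz] boundary_perturb_det[OF v _ bv_neg nz'] lam_nz
    by simp
  also have "\<dots> = (\<Prod>k=1..n. b_bv \<alpha> v k (- lam) / b_bv \<alpha> v k lam)"
    by (simp add: prod_dividef)
  \<comment> \<open>The prefactor of \<open>r_fun\<close> is odd in \<open>lam\<close>; its sign
    change cancels the minus in \<open>S_factor\<close>.\<close>
  also have "\<dots> = (\<Prod>k=1..n. S_factor \<alpha> v k lam)"
    using alpha lam_nz by (intro prod.cong) (auto simp: S_factor_def r_fun_def field_simps)
  finally show ?thesis .
qed

end
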